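(* For every $\alpha>0$ there exist $\beta=\beta(\alpha)>0$ and a constant $C=C(\alpha)>0$ such that the following holds. For every prime $p$, every multiplicative subgroup $H$ of $\mathbb{F}_p$ (i.e. every subgroup $H\le \mathbb{F}_p^\times$) with $|H|>p^{\alpha}$, and every non-trivial additive character $\psi:\mathbb{F}_p\to\mathbb{C}$, $$\left|\sum_{x\in H}\psi(x)\right|\le C\,p^{-\beta}\,|H|.$$
   Context: A non-trivial additive character of $\mathbb{F}_p$ is a function of the form $\psi(x)=\exp\left(\frac{2\pi i x\xi}{p}\right)$ for some $\xi\in\mathbb{F}_p^\times$. *)

theory Defs
  imports Complex_Main "HOL-Number_Theory.Residues"
begin

text \<open>
  The field with \<open>p\<close> elements is \<open>residue_ring (int p)\<close>, whose carrier is the set of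
  representatives \<open>{0..p - 1}\<close>. A character is a function on this carrier, so its values
  outside the carrier are left unconstrained. The exponential does not depend on the chosen
  integer representatives of the residue classes.
\<close>

definition nontrivial_additive_character :: "nat \<Rightarrow> (int \<Rightarrow> complex) \<Rightarrow> bool" where
  "nontrivial_additive_character p \<psi> \<longleftrightarrow>
     (\<exists>\<xi> \<in> Units (residue_ring (int p)).
        \<forall>x \<in> carrier (residue_ring (int p)).
          \<psi> x = exp (2 * of_real pi * \<i> * of_int x * of_int \<xi> / of_nat p))"

end

(*
  Suppose the normalised sum over H is large at some nonzero frequency. Its large spectrum is
  invariant under multiplication by H, and by Cauchy-Schwarz many differences of elements of one
  level set of the spectrum lie in the next one. Pigeonholing over the levels gives a level set A
  with p^c < |A| < p^(1-c) such that a p^(-small) proportion of the pairs in A x A have their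
  difference in a set of size at most p^small |A|. By Balog-Szemeredi-Gowers A contains a large
  set B of small doubling, and since A is H-invariant, B meets h B in a large set for many h in H.
  Put S = B - B. By Pluennecke and Ruzsa covering, S is an approximate group and h S is covered by
  few translates of S for these h. The elements t for which t S is covered by few translates of S
  are closed under sums and products, with polynomial losses. As long as the quotients of
  differences of such t do not exhaust the field, allowing one further polynomial loss squares
  their number, so after boundedly many steps every r in the field is such a quotient. Then
  |S + r S| is at most p^small |S| for all r, which contradicts an average over r.
*)

theory Submission
  imports
    Defs
    "HOL-Library.Set_Algebras"
    "HOL-Analysis.Convex"
    "HOL-Analysis.Complex_Transcendental"
    "Berlekamp_Zassenhaus.Finite_Field"
begin

section \<open>Sumsets\<close>

text \<open>Primality has to enter: in a field with q^2 elements the units of the subfield of order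
  q form a subgroup of size q - 1, and a non-trivial additive character that is trivial on the
  subfield shows no cancellation on it. It enters only as the hypothesis \<open>prime_field\<close>,
  and is used only in \<open>injective_linear_form\<close>: a set that contains 0 and is closed
  under adding 1 is the whole field. What is recorded about t is a cover of t S by translates of S
  rather than the size of S + t S, because covers compose directly under products, and a sum costs
  just one more cover of S + S. Every loss is a power of one parameter K \<ge> 2, which absorbs
  numerical constants as well. Since |H| > p^\<alpha>, the number of squarings depends on \<alpha>
  alone, so the total loss is K to an exponent independent of p, and K can be a small power of p. In
  these exponents 13 is the price of one squaring, and 833 = 7 * 119 combines the price 7 of
  clearing a quotient with the covering constant K^119.\<close>

lemma card_set_plus_le:
  assumes "finite A" "finite B"
  shows "card (A + B) \<le> card A * card B"
proof -
  have "A + B = (\<lambda>(a, b). a + b) ` (A \<times> B)"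
    by (auto simp: set_plus_def)
  then show ?thesis
    using card_image_le[of "A \<times> B" "\<lambda>(a, b). a + b"] assms by (simp add: card_cartesian_product)
qed

lemma card_le_card_set_plus:
  fixes A B :: "'a::ab_group_add set"
  assumes "finite A" "finite B" "B \<noteq> {}"
  shows "card A \<le> card (A + B)"
proof -
  obtain b where b: "b \<in> B" using assms by auto
  have "card A = card (A + {b})" by (simp add: card_plus_sing)
  also have "\<dots> \<le> card (A + B)"
    using assms b by (intro card_mono finite_set_plus set_plus_mono2) auto
  finally show ?thesis .
qed

lemma image_uminus_set_plus:
  fixes A B :: "'a::ab_group_add set"
  shows "uminus ` (A + B) = uminus ` A + uminus ` B"
  by (force simp: set_plus_def image_iff)

lemma card_uminus:
  fixes A :: "'a::ab_group_add set"
  shows "card (uminus ` A) = card A"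
  by (simp add: card_image)

text \<open>Fix one representation d = u - v for each difference d. The pair (x, d) can be recovered
  from u - x and x - v: their sum is d, and d determines u and hence x.\<close>

lemma ruzsa_triangle:
  fixes U V X :: "'a::ab_group_add set"
  assumes "finite U" "finite V" "finite X"
  shows "card X * card (U + uminus ` V) \<le> card (U + uminus ` X) * card (X + uminus ` V)"
proof -
  have "\<forall>d\<in>U + uminus ` V. \<exists>u v. u \<in> U \<and> v \<in> V \<and> d = u - v"
    by (auto simp: set_plus_def)
  then obtain f g where fg: "\<And>d. d \<in> U + uminus ` V \<Longrightarrow> f d \<in> U \<and> g d \<in> V \<and> d = f d - g d"
    by metis
  define \<phi> where "\<phi> = (\<lambda>(x, d). (f d - x, x - g d))"
  have "inj_on \<phi> (X \<times> (U + uminus ` V))"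
  proof (rule inj_onI, clarify)
    fix x d x' d'
    assume d: "d \<in> U + uminus ` V" and d': "d' \<in> U + uminus ` V"
      and eq: "\<phi> (x, d) = \<phi> (x', d')"
    have "d = (f d - x) + (x - g d)" using fg[OF d] by simp
    also have "\<dots> = (f d' - x') + (x' - g d')" using eq by (simp add: \<phi>_def)
    also have "\<dots> = d'" using fg[OF d'] by simp
    finally show "x = x' \<and> d = d'" using eq by (simp add: \<phi>_def)
  qed
  moreover have "\<phi> ` (X \<times> (U + uminus ` V)) \<subseteq> (U + uminus ` X) \<times> (X + uminus ` V)"
  proof (clarsimp simp: \<phi>_def)
    fix x d assume "x \<in> X" and d: "d \<in> U + uminus ` V"
    then show "f d - x \<in> U + uminus ` X \<and> x - g d \<in> X + uminus ` V"
      using fg[OF d] set_plus_intro[of "f d" U "- x" "uminus ` X"]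
        set_plus_intro[of x X "- g d" "uminus ` V"] by auto
  qed
  moreover have "finite ((U + uminus ` X) \<times> (X + uminus ` V))"
    using assms by (simp add: finite_set_plus)
  ultimately have "card (X \<times> (U + uminus ` V)) \<le> card ((U + uminus ` X) \<times> (X + uminus ` V))"
    by (metis card_inj_on_le)
  then show ?thesis by (simp add: card_cartesian_product)
qed

text \<open>Take X as large as possible with the translates x + B pairwise disjoint, encoded as
  injectivity of addition on X \<times> B. Disjointness bounds |X|. By maximality u + B meets some x
  + B, which puts u into x + B - B.\<close>

lemma ruzsa_covering:
  fixes B U :: "'a::ab_group_add set"
  assumes "finite B" "B \<noteq> {}" "finite U"
  obtains X where "X \<subseteq> U" "card X * card B \<le> card (U + B)" "U \<subseteq> X + (B + uminus ` B)"
proof -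
  define P where "P X \<longleftrightarrow> X \<subseteq> U \<and> inj_on (\<lambda>(x, b). x + b) (X \<times> B)" for X
  have "P {}" by (simp add: P_def)
  moreover have "\<And>X. P X \<Longrightarrow> card X < Suc (card U)"
    using assms by (simp add: P_def card_mono less_Suc_eq_le)
  ultimately obtain X where X: "P X" and max: "\<And>Y. P Y \<Longrightarrow> card Y \<le> card X"
    using ex_has_greatest_nat[of P "{}" card "Suc (card U)"] by auto
  have sub: "X \<subseteq> U" and inj: "inj_on (\<lambda>(x, b). x + b) (X \<times> B)" using X by (auto simp: P_def)
  have fin: "finite X" using sub assms finite_subset by blast
  have "card X * card B = card ((\<lambda>(x, b). x + b) ` (X \<times> B))"
    using card_image[OF inj] by (simp add: card_cartesian_product)
  also have "\<dots> \<le> card (U + B)"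
    using sub assms by (intro card_mono finite_set_plus) auto
  finally have 1: "card X * card B \<le> card (U + B)" .
  have 2: "U \<subseteq> X + (B + uminus ` B)"
  proof
    fix u assume u: "u \<in> U"
    show "u \<in> X + (B + uminus ` B)"
    proof (cases "u \<in> X")
      case True
      obtain b where "b \<in> B" using assms by auto
      then have "u + (b + - b) \<in> X + (B + uminus ` B)" using True by blast
      then show ?thesis by simp
    next
      case False
      have "\<not> P (insert u X)"
        using max[of "insert u X"] False fin by auto
      then have "\<not> inj_on (\<lambda>(x, b). x + b) (insert u X \<times> B)"
        using sub u by (auto simp: P_def)
      then obtain x b x' b' where xb: "x \<in> insert u X" "b \<in> B" "x' \<in> insert u X" "b' \<in> B"
        "x + b = x' + b'" "(x, b) \<noteq> (x', b')"
        unfolding inj_on_def by auto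
      have "x \<noteq> x'" using xb by auto
      moreover have "\<not> (x \<in> X \<and> x' \<in> X)"
        using xb inj unfolding inj_on_def by auto
      ultimately consider "x = u" "x' \<in> X" | "x' = u" "x \<in> X" using xb by auto
      then show ?thesis
      proof cases
        case 1
        then have "u = x' + (b' + - b)" using xb by (simp add: algebra_simps)
        then show ?thesis using 1 xb by blast
      next
        case 2
        then have "u = x + (b + - b')" using xb by (simp add: algebra_simps)
        then show ?thesis using 2 xb by blast
      qed
    qed
  qed
  show ?thesis using that sub 1 2 by blast
qed

section \<open>Pluennecke's inequality by the minimal ratio argument of Petridis\<close>

lemma petridis:
  fixes X B C :: "'a::ab_group_add set"
  assumes fin: "finite X" "finite B" and "finite C"
    and min: "\<And>Y. Y \<subseteq> X \<Longrightarrow> Y \<noteq> {} \<Longrightarrow> card (X + B) * card Y \<le> card (Y + B) * card X"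
  shows "card (X + B + C) * card X \<le> card (X + B) * card (X + C)"
  using \<open>finite C\<close>
proof (induction C rule: finite_induct)
  case empty
  then show ?case by simp
next
  case (insert c C)
  \<comment> \<open>\<open>Z\<close> collects the x whose translate by c is already in
    \<open>X + C\<close>; then \<open>Z + B + {c}\<close> is already in \<open>X + B + C\<close>. So
    adding c enlarges \<open>X + B + C\<close> by at most |X + B| - |Z + B| and \<open>X + C\<close>
    by exactly |X| - |Z|, and minimality of the ratio compares the two.\<close>
  define Z where "Z = {x\<in>X. (x + c) \<in> X + C}"
  have finC: "finite (X + C)" "finite (X + B + C)" "finite Z" "finite (X + B)"
    using fin insert by (auto simp: finite_set_plus Z_def)
  have ZX: "Z \<subseteq> X" by (auto simp: Z_def)
  have min': "card (X + B) * card Z \<le> card (Z + B) * card X"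
    using min[of Z] ZX by (cases "Z = {}") auto
  have card_shift: "card (A + {c}) = card A" for A :: "'a set"
    by (rule card_plus_sing)
  have ZBC: "Z + B + {c} \<subseteq> X + B + C"
  proof
    fix w assume "w \<in> Z + B + {c}"
    then obtain z b where zb: "z \<in> Z" "b \<in> B" "w = z + b + c" by (auto simp: set_plus_def)
    then obtain x c' where x: "x \<in> X" "c' \<in> C" "z + c = x + c'"
      by (auto simp: Z_def set_plus_def)
    have "w = x + b + c'" using zb x by (metis add.assoc add.commute)
    then show "w \<in> X + B + C" using zb x by blast
  qed
  have eq1: "X + B + insert c C = (X + B + C) \<union> ((X + B + {c}) - (Z + B + {c}))"
  proof -
    have "X + B + insert c C = (X + B + {c}) \<union> (X + B + C)"
      by (subst insert_is_Un) (rule set_plus_Un)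
    then show ?thesis using ZBC by auto
  qed
  have "card (X + B + insert c C) \<le> card (X + B + C) + card ((X + B + {c}) - (Z + B + {c}))"
    unfolding eq1 by (rule card_Un_le)
  also have "card ((X + B + {c}) - (Z + B + {c})) = card (X + B + {c}) - card (Z + B + {c})"
    using finC fin ZX by (intro card_Diff_subset finite_set_plus set_plus_mono2) auto
  finally have le1: "card (X + B + insert c C) \<le> card (X + B + C) + (card (X + B) - card (Z + B))"
    by (simp add: card_shift)
  have ZB: "card (Z + B) \<le> card (X + B)"
    using finC ZX by (intro card_mono set_plus_mono2) auto
  have eq2: "X + insert c C = (X + C) \<union> ((X - Z) + {c})"
  proof -
    have "Z + {c} \<subseteq> X + C" by (auto simp: Z_def set_plus_def)
    moreover have "X + {c} = (Z + {c}) \<union> ((X - Z) + {c})"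
      using ZX by (subst Un_set_plus[symmetric]) (simp add: Un_absorb1)
    moreover have "X + insert c C = (X + {c}) \<union> (X + C)"
      by (subst insert_is_Un) (rule set_plus_Un)
    ultimately show ?thesis by auto
  qed
  have "card (X + insert c C) = card (X + C) + card ((X - Z) + {c})"
    unfolding eq2
  proof (rule card_Un_disjoint)
    show "finite (X - Z + {c})" using fin by (simp add: finite_set_plus)
    show "(X + C) \<inter> (X - Z + {c}) = {}"
    proof (rule ccontr)
      assume "(X + C) \<inter> (X - Z + {c}) \<noteq> {}"
      then obtain w where w: "w \<in> X + C" "w \<in> X - Z + {c}" by blast
      then obtain x where "x \<in> X - Z" "w = x + c" by (auto elim!: set_plus_elim)
      then show False using w by (auto simp: Z_def)
    qed
  qed (use finC in simp)
  then have eq3: "card (X + insert c C) = card (X + C) + (card X - card Z)"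
    using card_Diff_subset[OF finC(3) ZX] by (simp add: card_shift)
  have ZX': "card Z \<le> card X" using ZX fin card_mono by blast
  have "card (X + B + insert c C) * card X
      \<le> (card (X + B + C) + (card (X + B) - card (Z + B))) * card X"
    using le1 by (rule mult_right_mono) simp
  also have "\<dots> = card (X + B + C) * card X + (card (X + B) * card X - card (Z + B) * card X)"
    by (simp add: algebra_simps diff_mult_distrib2)
  also have "\<dots> \<le> card (X + B) * card (X + C) + (card (X + B) * card X - card (X + B) * card Z)"
    using insert.IH min' by (intro add_mono diff_le_mono2)
  also have "\<dots> = card (X + B) * card (X + insert c C)"
    by (simp add: eq3 algebra_simps diff_mult_distrib2)
  finally show ?case .
qed

lemma exists_minimal_ratio:
  fixes A B :: "'a::ab_group_add set"
  assumes "finite A" "A \<noteq> {}"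
  obtains X where "X \<subseteq> A" "X \<noteq> {}"
    "\<And>Y. Y \<subseteq> A \<Longrightarrow> Y \<noteq> {} \<Longrightarrow> card (X + B) * card Y \<le> card (Y + B) * card X"
proof -
  define r where "r Y = real (card (Y + B)) / real (card Y)" for Y
  have fin: "finite (Pow A - {{}})" and ne: "Pow A - {{}} \<noteq> {}" using assms by auto
  define X where "X = arg_min_on r (Pow A - {{}})"
  have X: "X \<in> Pow A - {{}}" unfolding X_def by (rule arg_min_if_finite(1)[OF fin ne])
  have le: "r X \<le> r Y" if "Y \<in> Pow A - {{}}" for Y
    unfolding X_def using arg_min_least[OF fin ne that] .
  show ?thesis
  proof (rule that[of X])
    fix Y assume Y: "Y \<subseteq> A" "Y \<noteq> {}"
    have pos: "card X > 0" "card Y > 0"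
      using X Y assms by (auto simp: card_gt_0_iff intro: finite_subset)
    have "r X \<le> r Y" using le Y by auto
    then have "real (card (X + B)) * real (card Y) \<le> real (card (Y + B)) * real (card X)"
      using pos by (simp add: r_def divide_simps)
    then show "card (X + B) * card Y \<le> card (Y + B) * card X"
      by (metis of_nat_le_iff of_nat_mult)
  qed (use X in auto)
qed

text \<open>If X minimises |X - A| / |X|, repeated use of \<open>petridis\<close> gives |X - 3A|
  \<le> K^3 |X| and |X - 2A| \<le> K^2 |X|. The triangle inequality through X joins them, whence 5 =
  3 + 2. The combination 3A - 2A is S + S + A for S = A - A, the set whose size governs covers of S
  + S.\<close>

lemma pluennecke_diff:
  fixes A :: "'a::ab_group_add set" and K :: real
  assumes "finite A" "A \<noteq> {}" and dbl: "card (A + uminus ` A) \<le> K * card A"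
  shows "card (A + A + A + uminus ` (A + A)) \<le> K ^ 5 * card A"
proof -
  define B where "B = uminus ` A"
  have finB: "finite B" using assms by (simp add: B_def)
  obtain X where X: "X \<subseteq> A" "X \<noteq> {}"
    and min: "\<And>Y. Y \<subseteq> A \<Longrightarrow> Y \<noteq> {} \<Longrightarrow> card (X + B) * card Y \<le> card (Y + B) * card X"
    using exists_minimal_ratio[of A B] assms by metis
  have finX: "finite X" using X assms finite_subset by blast
  have posX: "card X > 0" using X finX by (simp add: card_gt_0_iff)
  have posA: "card A > 0" using assms by (simp add: card_gt_0_iff)
  have pos: "K \<ge> 0"
  proof -
    have "0 \<le> K * card A" using dbl of_nat_0_le_iff order_trans by blast
    then show ?thesis using posA by (simp add: zero_le_mult_iff)
  qed
  have "real (card (X + B)) * card A \<le> card (A + B) * card X"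
    using min[of A] assms(2) by (metis order_refl of_nat_le_iff of_nat_mult)
  also have "\<dots> \<le> K * card A * card X"
    using dbl by (simp add: B_def mult_right_mono)
  finally have XB: "real (card (X + B)) \<le> K * card X"
    using posA by simp
  have step: "real (card (X + B + C)) \<le> K * card (X + C)" if "finite C" for C
  proof -
    have "card (X + B + C) * card X \<le> card (X + B) * card (X + C)"
      using petridis[OF finX finB that] min X by (meson subset_trans)
    then have "real (card (X + B + C)) * card X \<le> card (X + B) * card (X + C)"
      by (metis of_nat_le_iff of_nat_mult)
    also have "\<dots> \<le> K * card X * card (X + C)"
      using XB by (simp add: mult_right_mono)
    finally show ?thesis using posX by (simp add: algebra_simps)
  qed
  have X2: "real (card (X + (B + B))) \<le> K\<^sup>2 * card X"
  proof -
    have "real (card (X + (B + B))) \<le> K * card (X + B)"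
      using step[OF finB] by (simp add: add.assoc)
    also have "\<dots> \<le> K * (K * card X)" using XB pos by (simp add: mult_left_mono)
    finally show ?thesis by (simp add: power2_eq_square)
  qed
  have X3: "real (card (X + (B + B + B))) \<le> K^3 * card X"
  proof -
    have "real (card (X + (B + B + B))) \<le> K * card (X + (B + B))"
      using step[of "B + B"] finB by (simp add: add.assoc finite_set_plus)
    also have "\<dots> \<le> K * (K\<^sup>2 * card X)" using X2 pos by (simp add: mult_left_mono)
    finally show ?thesis by (simp add: power2_eq_square power3_eq_cube)
  qed
  have "card (A + A + A + uminus ` X) = card (uminus ` (A + A + A + uminus ` X))"
    by (simp only: card_uminus)
  also have "uminus ` (A + A + A + uminus ` X) = X + (B + B + B)"
    by (simp add: image_uminus_set_plus B_def image_image add.commute)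
  finally have X3': "real (card (A + A + A + uminus ` X)) \<le> K^3 * card X" using X3 by simp
  have "card X * card (A + A + A + uminus ` (A + A))
      \<le> card (A + A + A + uminus ` X) * card (X + uminus ` (A + A))"
    using assms finX by (intro ruzsa_triangle finite_set_plus)
  then have "real (card X) * card (A + A + A + uminus ` (A + A))
      \<le> real (card (A + A + A + uminus ` X)) * card (X + uminus ` (A + A))"
    by (metis of_nat_le_iff of_nat_mult)
  also have "\<dots> \<le> (K^3 * card X) * (K\<^sup>2 * card X)"
    using X3' X2 pos by (intro mult_mono) (auto simp: image_uminus_set_plus B_def)
  also have "\<dots> = card X * (K^5 * card X)"
    by (simp add: algebra_simps power_numeral_reduce)
  finally have "real (card (A + A + A + uminus ` (A + A))) \<le> K^5 * card X"
    using posX by (simp add: mult_le_cancel_left)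
  also have "\<dots> \<le> K^5 * card A"
    using X assms pos by (intro mult_left_mono) (auto simp: card_mono)
  finally show ?thesis .
qed

section \<open>The Balog--Szemeredi--Gowers theorem\<close>

lemma card_filter_conv_sum:
  assumes "finite A"
  shows "real (card {a \<in> A. P a}) = (\<Sum>a\<in>A. of_bool (P a))"
  using assms by (simp add: Collect_conj_eq Int_commute)

lemma card_mult_le_of_fibers:
  fixes m :: real
  assumes "finite Q" "finite T" and "\<And>t. t \<in> T \<Longrightarrow> m \<le> card {q \<in> Q. s q = t}"
  shows "card T * m \<le> card Q"
proof -
  have "card T * m = (\<Sum>t\<in>T. m)" by simp
  also have "\<dots> \<le> (\<Sum>t\<in>T. real (card {q \<in> Q. s q = t}))"
    using assms by (intro sum_mono) auto
  also have "\<dots> = (\<Sum>t\<in>T. real (card {q \<in> {q\<in>Q. s q \<in> T}. s q = t}))"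
    by (intro sum.cong refl arg_cong[of _ _ real] arg_cong[of _ _ card]) auto
  also have "\<dots> = real (\<Sum>t\<in>T. \<Sum>q | q \<in> {q\<in>Q. s q \<in> T} \<and> s q = t. 1)"
    by simp
  also have "\<dots> = real (\<Sum>q\<in>{q\<in>Q. s q \<in> T}. 1)"
    using assms by (subst sum.group) auto
  also have "\<dots> \<le> card Q"
    using assms by (simp add: card_mono)
  finally show ?thesis .
qed

lemma dependent_random_choice:
  fixes A :: "'a set" and R :: "'a \<Rightarrow> 'a \<Rightarrow> bool" and K :: real
  assumes fin: "finite A" and "A \<noteq> {}" and K: "K > 0"
    and dense: "(card A)\<^sup>2 \<le> K * card {(a, b) \<in> A \<times> A. R a b}"
  defines "bad \<equiv> \<lambda>a b. 20 * K\<^sup>2 * card {v \<in> A. R a v \<and> R b v} < card A"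
  obtains N where "N \<subseteq> A" "card A \<le> 2 * K * card N"
    "10 * card {(a, b) \<in> N \<times> N. bad a b} \<le> (card N)\<^sup>2"
proof -
  define n where "n = real (card A)"
  have n: "n > 0" using assms by (simp add: n_def card_gt_0_iff)
  define N where "N v = {a \<in> A. R a v}" for v
  define b where "b v = real (card {(x, y) \<in> N v \<times> N v. bad x y})" for v
  have finN: "finite (N v)" for v using fin by (simp add: N_def)
  have cardN: "real (card (N v)) = (\<Sum>a\<in>A. of_bool (R a v))" for v
    unfolding N_def using fin by (rule card_filter_conv_sum)
  have "real (card {(a, b) \<in> A \<times> A. R a b}) = (\<Sum>p\<in>A \<times> A. of_bool (R (fst p) (snd p)))"
  proof -
    have "{(a, b) \<in> A \<times> A. R a b} = {p \<in> A \<times> A. R (fst p) (snd p)}" by auto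
    then show ?thesis using card_filter_conv_sum[of "A \<times> A"] fin by simp
  qed
  also have "\<dots> = (\<Sum>v\<in>A. real (card (N v)))"
    unfolding cardN by (subst sum.swap) (simp add: sum.cartesian_product case_prod_unfold)
  finally have edges: "n\<^sup>2 \<le> K * (\<Sum>v\<in>A. real (card (N v)))"
    using dense by (simp add: n_def)
  have "(\<Sum>v\<in>A. real (card (N v)))\<^sup>2 \<le> (\<Sum>v\<in>A. (real (card (N v)))\<^sup>2) * card A"
    by (rule sum_squared_le_sum_of_squares)
  moreover have "(n\<^sup>2)\<^sup>2 \<le> (K * (\<Sum>v\<in>A. real (card (N v))))\<^sup>2"
    using edges by (intro power_mono) auto
  ultimately have "(n\<^sup>2)\<^sup>2 \<le> K\<^sup>2 * ((\<Sum>v\<in>A. (real (card (N v)))\<^sup>2) * n)"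
    using K by (simp add: power_mult_distrib n_def) (smt (verit) mult_left_mono zero_le_power2)
  then have "n * (n ^ 3) \<le> n * (K\<^sup>2 * (\<Sum>v\<in>A. (real (card (N v)))\<^sup>2))"
    by (simp add: algebra_simps power_numeral_reduce)
  then have sq: "n ^ 3 \<le> K\<^sup>2 * (\<Sum>v\<in>A. (real (card (N v)))\<^sup>2)"
    using n by simp
  have b_eq: "b v = (\<Sum>p\<in>A \<times> A. of_bool (bad (fst p) (snd p)) * of_bool (R (fst p) v \<and> R (snd p) v))" for v
  proof -
    have "{(x, y) \<in> N v \<times> N v. bad x y}
        = {p \<in> A \<times> A. bad (fst p) (snd p) \<and> R (fst p) v \<and> R (snd p) v}"
      by (auto simp: N_def)
    then have "b v = (\<Sum>p\<in>A \<times> A. of_bool (bad (fst p) (snd p) \<and> R (fst p) v \<and> R (snd p) v))"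
      unfolding b_def using card_filter_conv_sum[of "A \<times> A"] fin by simp
    then show ?thesis by (simp only: of_bool_conj)
  qed
  have "(\<Sum>v\<in>A. b v) = (\<Sum>p\<in>A \<times> A. of_bool (bad (fst p) (snd p)) *
      real (card {v \<in> A. R (fst p) v \<and> R (snd p) v}))"
    unfolding b_eq by (subst sum.swap) (simp only: card_filter_conv_sum[OF fin] sum_distrib_left)
  also have "\<dots> \<le> (\<Sum>p\<in>A \<times> A. n / (20 * K\<^sup>2))"
  proof (rule sum_mono)
    fix p
    show "of_bool (bad (fst p) (snd p)) * real (card {v \<in> A. R (fst p) v \<and> R (snd p) v}) \<le> n / (20 * K\<^sup>2)"
      using K n by (auto simp: bad_def n_def field_simps)
  qed
  also have "\<dots> = n ^ 3 / (20 * K\<^sup>2)"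
    by (simp add: n_def card_cartesian_product power3_eq_cube)
  finally have bsum: "20 * K\<^sup>2 * (\<Sum>v\<in>A. b v) \<le> n ^ 3"
    using K by (simp add: field_simps)
  \<comment> \<open>First and second moment over a random v: the sum of |N v|^2 is at least n^3 /
    K^2 by Cauchy-Schwarz, while a bad pair lies in \<open>N v\<close> for fewer than n / (20 K^2)
    of the v. The 20 in \<open>bad\<close> is twice the 10 of the conclusion, so that bad pairs
    remove at most half of the sum.\<close>
  have "\<exists>v\<in>A. n\<^sup>2 \<le> 2 * K\<^sup>2 * ((real (card (N v)))\<^sup>2 - 10 * b v)"
  proof (rule ccontr)
    assume "\<not> ?thesis"
    then have "\<And>v. v \<in> A \<Longrightarrow> 2 * K\<^sup>2 * ((real (card (N v)))\<^sup>2 - 10 * b v) < n\<^sup>2" by force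
    then have "(\<Sum>v\<in>A. 2 * K\<^sup>2 * ((real (card (N v)))\<^sup>2 - 10 * b v)) < (\<Sum>v\<in>A. n\<^sup>2)"
      using assms by (intro sum_strict_mono) auto
    also have "\<dots> = n ^ 3" by (simp add: n_def power_numeral_reduce)
    also have "(\<Sum>v\<in>A. 2 * K\<^sup>2 * ((real (card (N v)))\<^sup>2 - 10 * b v))
       = 2 * (K\<^sup>2 * (\<Sum>v\<in>A. (real (card (N v)))\<^sup>2)) - 20 * K\<^sup>2 * (\<Sum>v\<in>A. b v)"
    proof -
      have "2 * K\<^sup>2 * ((real (card (N v)))\<^sup>2 - 10 * b v)
          = 2 * (K\<^sup>2 * (real (card (N v)))\<^sup>2) - 20 * K\<^sup>2 * b v" for v
        by (simp add: algebra_simps)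
      then show ?thesis by (simp only: sum_subtractf sum_distrib_left)
    qed
    finally show False using sq bsum by linarith
  qed
  then obtain v where v: "v \<in> A" "n\<^sup>2 \<le> 2 * K\<^sup>2 * ((real (card (N v)))\<^sup>2 - 10 * b v)" by blast
  have b0: "b v \<ge> 0" by (simp add: b_def)
  have "10 * b v \<le> (real (card (N v)))\<^sup>2"
  proof (rule ccontr)
    assume "\<not> ?thesis"
    then have "2 * K\<^sup>2 * ((real (card (N v)))\<^sup>2 - 10 * b v) < 0"
      using K by (intro mult_pos_neg) auto
    then show False using v(2) n by (smt (verit) zero_le_power2)
  qed
  then have 1: "real (10 * card {(x, y) \<in> N v \<times> N v. bad x y}) \<le> real ((card (N v))\<^sup>2)"
    by (simp add: b_def)
  have "n\<^sup>2 \<le> 2 * K\<^sup>2 * (real (card (N v)))\<^sup>2"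
    using v(2) b0 K by (smt (verit, best) mult_left_mono zero_le_power2)
  also have "\<dots> \<le> (2 * K * card (N v))\<^sup>2"
    by (simp add: power_mult_distrib)
  finally have 2: "n \<le> 2 * K * card (N v)"
    by (rule power2_le_imp_le) (use K in simp)
  show ?thesis
  proof (rule that)
    show "N v \<subseteq> A" by (auto simp: N_def)
    show "card A \<le> 2 * K * card (N v)" using 2 by (simp add: n_def)
    show "10 * card {(x, y) \<in> N v \<times> N v. bad x y} \<le> (card (N v))\<^sup>2"
      using 1 by (simp only: of_nat_le_iff)
  qed
qed

text \<open>Markov's inequality: at most |N|^2 / 10 bad pairs leave at most 4/10 of the vertices
  with more than |N| / 4 bad partners.\<close>

lemma few_high_degrees:
  assumes "finite N" and bad: "10 * card {(a, b) \<in> N \<times> N. bad a b} \<le> (card N)\<^sup>2"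
  shows "card N \<le> 2 * card {a \<in> N. 4 * card {b \<in> N. bad a b} \<le> card N}"
proof (cases "N = {}")
  case False
  define G where "G = {a \<in> N. 4 * card {b \<in> N. bad a b} \<le> card N}"
  have pos: "card N > 0" using False assms by (simp add: card_gt_0_iff)
  have "{(a, b) \<in> N \<times> N. bad a b} = (SIGMA a:N. {b \<in> N. bad a b})" by auto
  then have "card {(a, b) \<in> N \<times> N. bad a b} = (\<Sum>a\<in>N. card {b \<in> N. bad a b})"
    using assms by simp
  also have "\<dots> \<ge> (\<Sum>a\<in>N - G. card {b \<in> N. bad a b})"
    using assms by (intro sum_mono2) auto
  finally have "4 * (\<Sum>a\<in>N - G. card {b \<in> N. bad a b}) \<le> 4 * card {(a, b) \<in> N \<times> N. bad a b}"
    by simp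
  moreover have "(\<Sum>a\<in>N - G. card N) \<le> (\<Sum>a\<in>N - G. 4 * card {b \<in> N. bad a b})"
    by (intro sum_mono) (auto simp: G_def)
  moreover have "(\<Sum>a\<in>N - G. card N) = card (N - G) * card N" by simp
  moreover have "(\<Sum>a\<in>N - G. 4 * card {b \<in> N. bad a b}) = 4 * (\<Sum>a\<in>N - G. card {b \<in> N. bad a b})"
    by (simp add: sum_distrib_left)
  ultimately have "10 * (card (N - G) * card N) \<le> 4 * (card N * card N)"
    using bad unfolding power2_eq_square by linarith
  then have "(10 * card (N - G)) * card N \<le> (4 * card N) * card N" by (simp only: mult.assoc)
  then have "10 * card (N - G) \<le> 4 * card N" using pos by (metis mult_le_cancel2)
  moreover have "card (N - G) = card N - card G" "card G \<le> card N"
    using assms by (auto simp: G_def intro!: card_Diff_subset card_mono)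
  ultimately show ?thesis unfolding G_def by linarith
qed simp

text \<open>B consists of the vertices with few bad partners in a randomly chosen neighbourhood. A
  difference a - a' from B then has many representations (a - b) + (b - c) + (c - b') + (b' - a')
  with all four terms in D, where c is a good partner of a and a', and b, b' are common neighbours.
  Only |D|^4 quadruples are available, so there are few differences.\<close>

theorem balog_szemeredi_gowers:
  fixes A D :: "'a::ab_group_add set" and K :: real
  assumes fin: "finite A" "finite D" and "A \<noteq> {}" and K: "K > 0"
    and sym: "uminus ` D = D"
    and dense: "(card A)\<^sup>2 \<le> K * card {(a, b) \<in> A \<times> A. a - b \<in> D}"
    and D: "card D \<le> K * card A"
  obtains B where "B \<subseteq> A" "card A \<le> 4 * K * card B"
    "card (B + uminus ` B) \<le> 1600 * K ^ 9 * card A"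
proof -
  define n where "n = real (card A)"
  have n: "n > 0" using assms by (simp add: n_def card_gt_0_iff)
  have symD: "- d \<in> D \<longleftrightarrow> d \<in> D" for d
    using sym by (metis add.inverse_inverse image_eqI)
  define W where "W a b = {v \<in> A. a - v \<in> D \<and> b - v \<in> D}" for a b
  define bad where "bad a b \<longleftrightarrow> 20 * K\<^sup>2 * card (W a b) < card A" for a b
  have bad_sym: "bad a b \<longleftrightarrow> bad b a" for a b
    unfolding bad_def W_def by (simp add: conj_commute)
  obtain N where N: "N \<subseteq> A" "card A \<le> 2 * K * card N"
    "10 * card {(a, b) \<in> N \<times> N. bad a b} \<le> (card N)\<^sup>2"
    using dependent_random_choice[of A K "\<lambda>a b. a - b \<in> D"] assms
    unfolding bad_def W_def by blast
  have finN: "finite N" using N fin finite_subset by blast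
  define B where "B = {a \<in> N. 4 * card {b \<in> N. bad a b} \<le> card N}"
  have BN: "card N \<le> 2 * card B"
    unfolding B_def using few_high_degrees[OF finN N(3)] .
  have BA: "B \<subseteq> A" using N by (auto simp: B_def)
  have finB: "finite B" using BA fin finite_subset by blast
  have "2 * K * card N \<le> 2 * K * (2 * card B)"
    using BN K by (intro mult_left_mono) (auto simp flip: of_nat_le_iff)
  then have 1: "card A \<le> 4 * K * card B" using N(2) by simp
  define Q where "Q = D \<times> D \<times> D \<times> D"
  define s where "s = (\<lambda>(d1, d2, d3, d4). d1 + d2 + d3 + d4 :: 'a)"
  define \<epsilon> where "\<epsilon> = n / (20 * K\<^sup>2)"
  have \<epsilon>: "\<epsilon> \<ge> 0" using n K by (simp add: \<epsilon>_def)
  \<comment> \<open>Each of a and a' excludes at most a quarter of \<open>N\<close>, so half of the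
    c remain, and each common neighbourhood has at least \<open>\<epsilon>\<close> elements. With
    |N| \<ge> n / (2 K), m is at least n^3 / (1600 K^5); dividing (K n)^4 by this gives 1600 K^9
    n.\<close>
  define m where "m = card N / 2 * \<epsilon>\<^sup>2"
  have fibers: "m \<le> card {q \<in> Q. s q = t}" if t: "t \<in> B + uminus ` B" for t
  proof -
    obtain a a' where a: "a \<in> B" "a' \<in> B" "t = a - a'" using t by (auto simp: set_plus_def)
    define G where "G = {c \<in> N. \<not> bad a c \<and> \<not> bad a' c}"
    define P where "P = (SIGMA c:G. W a c \<times> W c a')"
    have finW: "finite (W x y)" for x y using fin by (simp add: W_def)
    have finG: "finite G" using finN by (simp add: G_def)
    have "N - G = {c \<in> N. bad a c} \<union> {c \<in> N. bad a' c}" by (auto simp: G_def)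
    then have "card (N - G) \<le> card {c \<in> N. bad a c} + card {c \<in> N. bad a' c}"
      using card_Un_le by metis
    moreover have "card (N - G) = card N - card G" "card G \<le> card N"
      using finN by (auto simp: G_def intro!: card_Diff_subset card_mono)
    moreover have "4 * card {c \<in> N. bad a c} \<le> card N" "4 * card {c \<in> N. bad a' c} \<le> card N"
      using a by (auto simp: B_def)
    ultimately have "card N \<le> 2 * card G" by linarith
    then have "card N / 2 \<le> card G" by simp
    then have "m \<le> card G * \<epsilon>\<^sup>2" unfolding m_def by (rule mult_right_mono) simp
    also have "\<dots> = (\<Sum>c\<in>G. \<epsilon> * \<epsilon>)" by (simp add: power2_eq_square)
    also have "\<dots> \<le> (\<Sum>c\<in>G. real (card (W a c)) * real (card (W c a')))"
    proof (intro sum_mono mult_mono)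
      fix c assume c: "c \<in> G"
      show "\<epsilon> \<le> card (W a c)" "\<epsilon> \<le> card (W c a')"
        using c K bad_sym[of a' c] by (auto simp: G_def bad_def \<epsilon>_def n_def field_simps)
    qed (use \<epsilon> in auto)
    also have "\<dots> = real (card P)"
      using finG finW by (simp add: P_def card_cartesian_product)
    also have "\<dots> \<le> real (card {q \<in> Q. s q = t})"
    proof -
      define f where "f = (\<lambda>(c, b, b'). (a - b, b - c, c - b', b' - a'))"
      have "inj_on f P" by (auto simp: inj_on_def f_def)
      moreover have "f ` P \<subseteq> {q \<in> Q. s q = t}"
      proof clarsimp
        fix c b b' assume "(c, b, b') \<in> P"
        then have "a - b \<in> D" "- (c - b) \<in> D" "c - b' \<in> D" "- (a' - b') \<in> D"
          unfolding symD by (auto simp: P_def W_def)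
        then show "f (c, b, b') \<in> Q \<and> s (f (c, b, b')) = t"
          using a by (simp add: f_def Q_def s_def)
      qed
      moreover have "finite {q \<in> Q. s q = t}" using fin by (simp add: Q_def)
      ultimately have "card P \<le> card {q \<in> Q. s q = t}" by (rule card_inj_on_le)
      then show ?thesis by simp
    qed
    finally show ?thesis .
  qed
  have "card (B + uminus ` B) * m \<le> card Q"
    using fibers fin finB by (intro card_mult_le_of_fibers[where s = s]) (auto simp: Q_def finite_set_plus)
  also have "real (card Q) = (real (card D)) ^ 4"
    by (simp add: Q_def card_cartesian_product power_numeral_reduce)
  also have "\<dots> \<le> (K * n) ^ 4" using D by (intro power_mono) (auto simp: n_def)
  finally have le: "card (B + uminus ` B) * m \<le> K ^ 4 * n ^ 4" by (simp add: power_mult_distrib)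
  have "n \<le> 2 * K * card N" using N(2) by (simp add: n_def)
  then have "n / (4 * K) * \<epsilon>\<^sup>2 \<le> m"
    unfolding m_def using K by (intro mult_right_mono) (auto simp: field_simps)
  then have "card (B + uminus ` B) * (n / (4 * K) * \<epsilon>\<^sup>2) \<le> card (B + uminus ` B) * m"
    by (rule mult_left_mono) simp
  also note le
  also have "n / (4 * K) * \<epsilon>\<^sup>2 = n ^ 3 / (1600 * K ^ 5)"
    by (simp add: \<epsilon>_def field_simps power_numeral_reduce)
  finally have "card (B + uminus ` B) * n ^ 3 \<le> (K ^ 4 * n ^ 4) * (1600 * K ^ 5)"
    using K by (simp add: field_simps)
  also have "\<dots> = (1600 * K ^ 9 * n) * n ^ 3"
    by (simp add: algebra_simps power_numeral_reduce)
  finally have 2: "card (B + uminus ` B) \<le> 1600 * K ^ 9 * n"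
    using n by simp
  show ?thesis using that[of B] BA 1 2 by (simp add: n_def)
qed

section \<open>Dilates of approximate subgroups\<close>

text \<open>If S were an additive subgroup, the t with t S \<subseteq> S would form a ring. The
  covering number K measures how well this ring structure survives for an approximate
  subgroup.\<close>

definition dilate_cover :: "'a::comm_ring set \<Rightarrow> real \<Rightarrow> 'a \<Rightarrow> bool" where
  "dilate_cover S K t \<longleftrightarrow> (\<exists>X. finite X \<and> real (card X) \<le> K \<and> (*) t ` S \<subseteq> X + S)"

text \<open>The set (T - T) / (T - T), with the denominator multiplied out because a ring has no
  division.\<close>

definition quotients :: "'a::ring set \<Rightarrow> 'a set" where
  "quotients T = {r. \<exists>a\<in>T. \<exists>b\<in>T. \<exists>c\<in>T. \<exists>d\<in>T. c \<noteq> d \<and> r * (c - d) = a - b}"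

lemma dilate_cover_mono: "dilate_cover S K t \<Longrightarrow> K \<le> L \<Longrightarrow> dilate_cover S L t"
  unfolding dilate_cover_def by (meson order_trans)

lemma card_set_plus_real_le:
  fixes K L :: real
  assumes "finite X" "finite Y" "real (card X) \<le> K" "real (card Y) \<le> L"
  shows "real (card (X + Y)) \<le> K * L"
proof -
  have "real (card (X + Y)) \<le> real (card X) * real (card Y)"
    using card_set_plus_le[OF assms(1,2)] by (metis of_nat_le_iff of_nat_mult)
  also have "\<dots> \<le> K * L"
    using assms by (intro mult_mono) auto
  finally show ?thesis .
qed

lemma image_mult_set_plus:
  fixes A B :: "'a::semiring set"
  shows "(*) t ` (A + B) = (*) t ` A + (*) t ` B"
  by (force simp: set_plus_def image_iff distrib_left)

lemma dilate_cover_mult: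
  assumes "dilate_cover S K s" "dilate_cover S L t"
  shows "dilate_cover S (K * L) (s * t)"
proof -
  obtain X where X: "finite X" "card X \<le> K" "(*) s ` S \<subseteq> X + S"
    using assms by (auto simp: dilate_cover_def)
  obtain Y where Y: "finite Y" "card Y \<le> L" "(*) t ` S \<subseteq> Y + S"
    using assms by (auto simp: dilate_cover_def)
  have "(*) (s * t) ` S = (*) s ` (*) t ` S" by (simp add: image_image mult.assoc)
  also have "\<dots> \<subseteq> (*) s ` (Y + S)" using Y by (intro image_mono)
  also have "\<dots> = (*) s ` Y + (*) s ` S" by (rule image_mult_set_plus)
  also have "\<dots> \<subseteq> (*) s ` Y + (X + S)" using X by (intro set_plus_mono2) auto
  also have "\<dots> = (X + (*) s ` Y) + S" by (simp add: ac_simps)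
  finally have "(*) (s * t) ` S \<subseteq> (X + (*) s ` Y) + S" .
  moreover have "real (card (X + (*) s ` Y)) \<le> K * L"
    using X Y card_image_le[of Y "(*) s"] by (intro card_set_plus_real_le) auto
  ultimately show ?thesis
    unfolding dilate_cover_def using X Y by (intro exI[of _ "X + (*) s ` Y"]) (auto intro: finite_set_plus)
qed

locale approximate_subgroup =
  fixes S :: "'a::{field,finite} set" and M :: real
  assumes nonempty: "S \<noteq> {}"
    and sym: "uminus ` S = S"
    and cover: "\<exists>Z. card Z \<le> M \<and> S + S \<subseteq> Z + S"
begin

lemma M_ge_1: "M \<ge> 1"
proof -
  obtain Z where Z: "card Z \<le> M" "S + S \<subseteq> Z + S" using cover by blast
  have "S + S \<noteq> {}" using nonempty by (auto simp: set_plus_def)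
  then have "Z \<noteq> {}" using Z by auto
  then have "card Z \<ge> 1" by (simp add: Suc_leI card_gt_0_iff)
  then show ?thesis using Z by linarith
qed

lemma dilate_cover_uminus:
  assumes "dilate_cover S K t" shows "dilate_cover S K (- t)"
proof -
  have "(*) (- t) ` S = (*) t ` uminus ` S" by (simp add: image_image)
  then show ?thesis using assms by (simp add: dilate_cover_def sym)
qed

lemma set_plus_dilates_cover:
  assumes "dilate_cover S K s" "dilate_cover S L t"
  obtains W where "card W \<le> K * L * M" "(*) s ` S + (*) t ` S \<subseteq> W + S"
proof -
  obtain X where X: "card X \<le> K" "(*) s ` S \<subseteq> X + S"
    using assms by (auto simp: dilate_cover_def)
  obtain Y where Y: "card Y \<le> L" "(*) t ` S \<subseteq> Y + S"
    using assms by (auto simp: dilate_cover_def)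
  obtain Z where Z: "card Z \<le> M" "S + S \<subseteq> Z + S" using cover by blast
  have "(*) s ` S + (*) t ` S \<subseteq> (X + S) + (Y + S)"
    using X Y by (intro set_plus_mono2)
  also have "\<dots> = (X + Y) + (S + S)" by (simp add: ac_simps)
  also have "\<dots> \<subseteq> (X + Y) + (Z + S)" by (rule set_plus_mono2[OF order_refl Z(2)])
  also have "\<dots> = (X + Y + Z) + S" by (simp add: ac_simps)
  finally have "(*) s ` S + (*) t ` S \<subseteq> (X + Y + Z) + S" .
  moreover have "real (card (X + Y + Z)) \<le> K * L * M"
    using X Y Z by (intro card_set_plus_real_le) auto
  ultimately show ?thesis using that by blast
qed

lemma card_set_plus_dilates_le:
  assumes "dilate_cover S K s" "dilate_cover S L t"
  shows "card ((*) s ` S + (*) t ` S) \<le> K * L * M * card S"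
proof -
  obtain W where W: "card W \<le> K * L * M" "(*) s ` S + (*) t ` S \<subseteq> W + S"
    using set_plus_dilates_cover[OF assms] by blast
  have "real (card ((*) s ` S + (*) t ` S)) \<le> card (W + S)"
    using W by (simp add: card_mono)
  also have "\<dots> \<le> K * L * M * card S"
    using W by (intro card_set_plus_real_le) auto
  finally show ?thesis .
qed

lemma dilate_cover_add:
  assumes "dilate_cover S K s" "dilate_cover S L t"
  shows "dilate_cover S (K * L * M) (s + t)"
proof -
  obtain W where W: "card W \<le> K * L * M" "(*) s ` S + (*) t ` S \<subseteq> W + S"
    using set_plus_dilates_cover[OF assms] by blast
  have "(*) (s + t) ` S \<subseteq> (*) s ` S + (*) t ` S"
    by (auto simp: distrib_right)
  then show ?thesis using W unfolding dilate_cover_def by (metis finite_code subset_trans)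
qed

lemma dilate_cover_diff:
  assumes "dilate_cover S K s" "dilate_cover S L t"
  shows "dilate_cover S (K * L * M) (s - t)"
  using dilate_cover_add[OF assms(1) dilate_cover_uminus[OF assms(2)]] by simp

end

text \<open>The first quotient \<open>r\<close> such that \<open>r + 1\<close> is no longer a quotient makes
  \<open>x + (r + 1) * y\<close> injective on \<open>T \<times> T\<close>; the denominator of \<open>r\<close> is then cleared.\<close>

lemma injective_linear_form:
  fixes T :: "'a::field set"
  assumes prime_field: "\<And>x::'a. \<exists>n. x = of_nat n"
    and two: "s \<in> T" "t \<in> T" "s \<noteq> t"
    and "quotients T \<noteq> UNIV"
  obtains a b c d where "a \<in> T" "b \<in> T" "c \<in> T" "d \<in> T"
    "inj_on (\<lambda>(x, y). (c - d) * x + (a - b + (c - d)) * y) (T \<times> T)"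
proof -
  \<comment> \<open>Zero is a quotient because T has two distinct elements. If adding 1 never left
    the quotients, every \<open>of_nat n\<close> would be one, hence every element of the
    field.\<close>
  have "\<exists>r\<in>quotients T. r + 1 \<notin> quotients T"
  proof (rule ccontr)
    assume "\<not> ?thesis"
    then have step: "r + 1 \<in> quotients T" if "r \<in> quotients T" for r using that by blast
    have "0 \<in> quotients T"
      unfolding quotients_def using two by force
    then have "of_nat n \<in> quotients T" for n
    proof (induction n)
      case (Suc n)
      then show ?case using step[of "of_nat n"] by (simp add: add.commute)
    qed simp
    then have "quotients T = UNIV" using prime_field by (metis UNIV_eq_I)
    then show False using assms by blast
  qed
  then obtain r where r: "r \<in> quotients T" "r + 1 \<notin> quotients T" by blast
  then obtain a b c d where abcd: "a \<in> T" "b \<in> T" "c \<in> T" "d \<in> T" "c \<noteq> d" "r * (c - d) = a - b"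
    by (auto simp: quotients_def)
  have "inj_on (\<lambda>(x, y). (c - d) * x + (a - b + (c - d)) * y) (T \<times> T)"
  proof (rule inj_onI, clarify)
    fix x y x' y' assume T: "x \<in> T" "y \<in> T" "x' \<in> T" "y' \<in> T"
      and eq: "(c - d) * x + (a - b + (c - d)) * y = (c - d) * x' + (a - b + (c - d)) * y'"
    have e: "a - b + (c - d) = (r + 1) * (c - d)" using abcd by (simp add: algebra_simps)
    have "(c - d) * (x + (r + 1) * y) = (c - d) * x + (a - b + (c - d)) * y" for x y
      unfolding e by (simp add: algebra_simps)
    then have "(c - d) * (x + (r + 1) * y) = (c - d) * (x' + (r + 1) * y')"
      using eq by simp
    then have eq': "x + (r + 1) * y = x' + (r + 1) * y'" using abcd by simp
    then have "(r + 1) * (y' - y) = x - x'" by (simp add: algebra_simps)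
    then have "r + 1 \<in> quotients T" if "y \<noteq> y'"
      unfolding quotients_def using T that
      by (intro CollectI bexI[of _ x] bexI[of _ x'] bexI[of _ y'] bexI[of _ y]) auto
    then have "y = y'" using r(2) by auto
    then show "x = x' \<and> y = y'" using eq' by simp
  qed
  then show ?thesis using that abcd by blast
qed

section \<open>Growth of the set of covering dilates\<close>

context approximate_subgroup
begin

lemma card_dilate_cover_square:
  fixes K :: real
  assumes prime_field: "\<And>x::'a. \<exists>n. x = of_nat n"
    and two: "2 \<le> card {t. dilate_cover S K t}"
    and "quotients {t. dilate_cover S K t} \<noteq> UNIV"
  shows "(card {t. dilate_cover S K t})\<^sup>2 \<le> card {t. dilate_cover S (K ^ 8 * M ^ 5) t}"
proof -
  define T where "T = {t. dilate_cover S K t}"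
  obtain s t where st: "s \<in> T" "t \<in> T" "s \<noteq> t"
    using two card_le_Suc0_iff_eq[of T] unfolding T_def by fastforce
  obtain a b c d where abcd: "a \<in> T" "b \<in> T" "c \<in> T" "d \<in> T"
    and inj: "inj_on (\<lambda>(x, y). (c - d) * x + (a - b + (c - d)) * y) (T \<times> T)"
    using injective_linear_form[OF prime_field st] assms(3) unfolding T_def by blast
  have "(\<lambda>(x, y). (c - d) * x + (a - b + (c - d)) * y) ` (T \<times> T) \<subseteq> {t. dilate_cover S (K ^ 8 * M ^ 5) t}"
  proof clarify
    fix x y assume x: "x \<in> T" and y: "y \<in> T"
    \<comment> \<open>One factor K for each occurrence of an element of \<open>T\<close>, three in
      the first summand and five in the second; one factor M for each of the five additions and
      subtractions.\<close>
    have "dilate_cover S (((K * K * M) * K) * (((K * K * M) * (K * K * M) * M) * K) * M)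
        ((c - d) * x + (a - b + (c - d)) * y)"
      using x y abcd unfolding T_def by (intro dilate_cover_add dilate_cover_mult dilate_cover_diff) auto
    also have "((K * K * M) * K) * (((K * K * M) * (K * K * M) * M) * K) * M = K ^ 8 * M ^ 5"
      by (simp add: power_numeral_reduce algebra_simps)
    finally show "dilate_cover S (K ^ 8 * M ^ 5) ((c - d) * x + (a - b + (c - d)) * y)" .
  qed
  then have "card (T \<times> T) \<le> card {t. dilate_cover S (K ^ 8 * M ^ 5) t}"
    using inj by (intro card_inj_on_le) auto
  then show ?thesis by (simp add: T_def card_cartesian_product power2_eq_square)
qed

text \<open>As long as the quotients miss an element, one step squares the cardinality, and J such
  steps would outgrow the field. A step turns a covering constant L into L^8 M^5 \<le> L^13.\<close>

lemma quotients_eventually_UNIV: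
  fixes K :: real
  assumes prime_field: "\<And>x::'a. \<exists>n. x = of_nat n"
    and K: "M \<le> K"
    and two: "2 \<le> card {t. dilate_cover S K t}"
    and big: "CARD('a) < (card {t. dilate_cover S K t}) ^ (2 ^ J)"
  obtains n where "n < J" "quotients {t. dilate_cover S (K ^ (13 ^ n)) t} = UNIV"
proof -
  define T where "T n = {t. dilate_cover S (K ^ (13 ^ n)) t}" for n
  have K1: "K \<ge> 1" using M_ge_1 K by simp
  have "\<exists>n<J. quotients (T n) = UNIV"
  proof (rule ccontr)
    assume neg: "\<not> ?thesis"
    have "card (T 0) ^ (2 ^ n) \<le> card (T n)" if "n \<le> J" for n
      using that
    proof (induction n)
      case (Suc n)
      have T0: "2 \<le> card (T 0)" using two by (simp add: T_def)
      have IH: "card (T 0) ^ (2 ^ n) \<le> card (T n)" using Suc by simp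
      have "card (T 0) \<le> card (T 0) ^ (2 ^ n)" using T0 by (intro self_le_power) auto
      then have "2 \<le> card (T n)" using T0 IH by simp
      moreover have "quotients (T n) \<noteq> UNIV" using neg Suc by auto
      ultimately have "(card (T n))\<^sup>2 \<le> card {t. dilate_cover S ((K ^ (13 ^ n)) ^ 8 * M ^ 5) t}"
        unfolding T_def by (intro card_dilate_cover_square prime_field)
      also have "\<dots> \<le> card (T (Suc n))"
      proof (intro card_mono)
        have "M ^ 5 \<le> K ^ 5" using K M_ge_1 by (intro power_mono) auto
        also have "\<dots> \<le> (K ^ (13 ^ n)) ^ 5" using K1 by (intro power_mono self_le_power) auto
        finally have "(K ^ (13 ^ n)) ^ 8 * M ^ 5 \<le> (K ^ (13 ^ n)) ^ 8 * (K ^ (13 ^ n)) ^ 5"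
          using K1 by (intro mult_left_mono) auto
        also have "\<dots> = (K ^ (13 ^ n)) ^ 13" by (simp flip: power_add)
        also have "\<dots> = K ^ (13 ^ Suc n)" by (simp add: mult.commute flip: power_mult)
        finally show "{t. dilate_cover S ((K ^ (13 ^ n)) ^ 8 * M ^ 5) t} \<subseteq> T (Suc n)"
          unfolding T_def using dilate_cover_mono by blast
      qed auto
      finally have "(card (T n))\<^sup>2 \<le> card (T (Suc n))" .
      moreover have "(card (T 0) ^ (2 ^ n))\<^sup>2 \<le> (card (T n))\<^sup>2" using IH by (intro power_mono) auto
      ultimately show ?case by (simp add: mult.commute flip: power_mult)
    qed simp
    then have "card (T 0) ^ (2 ^ J) \<le> card (T J)" by simp
    also have "\<dots> \<le> CARD('a)" by (intro card_mono) auto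
    finally show False using big by (simp add: T_def)
  qed
  then show ?thesis using that unfolding T_def by blast
qed

text \<open>Write r = u / v with u and v differences of covering dilates. Multiplication by v is a
  bijection from S + r S to v S + u S. The differences cost L^3 each and the sum of the two dilates
  one more factor, whence 7.\<close>

lemma card_set_plus_dilate_le:
  fixes K :: real
  assumes prime_field: "\<And>x::'a. \<exists>n. x = of_nat n"
    and K: "M \<le> K"
    and two: "2 \<le> card {t. dilate_cover S K t}"
    and big: "CARD('a) < (card {t. dilate_cover S K t}) ^ (2 ^ J)"
  shows "card (S + (*) r ` S) \<le> K ^ (7 * 13 ^ J) * card S"
proof -
  obtain n where n: "n < J" "quotients {t. dilate_cover S (K ^ (13 ^ n)) t} = UNIV"
    by (rule quotients_eventually_UNIV[OF assms])
  define L where "L = K ^ (13 ^ n)"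
  have K1: "K \<ge> 1" using M_ge_1 K by simp
  then have L1: "L \<ge> 1" unfolding L_def by (rule one_le_power)
  have "K \<le> L" unfolding L_def using K1 by (intro self_le_power) auto
  then have M_le: "M \<le> L" using K by simp
  have "r \<in> quotients {t. dilate_cover S L t}" using n by (simp add: L_def)
  then obtain a b c d where abcd: "dilate_cover S L a" "dilate_cover S L b" "dilate_cover S L c" "dilate_cover S L d" "c \<noteq> d"
    "r * (c - d) = a - b"
    by (auto simp: quotients_def)
  define u where "u = a - b"
  define v where "v = c - d"
  have v: "v \<noteq> 0" "v * r = u" using abcd by (auto simp: u_def v_def mult.commute)
  have "card (S + (*) r ` S) = card ((*) v ` (S + (*) r ` S))"
    using v by (intro card_image[symmetric]) (simp add: inj_on_def)
  also have "(*) v ` (S + (*) r ` S) = (*) v ` S + (*) u ` S"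
    using v by (simp add: image_mult_set_plus image_image mult.assoc[symmetric])
  also have "real (card \<dots>) \<le> (L * L * M) * (L * L * M) * M * card S"
    unfolding u_def v_def using abcd by (intro card_set_plus_dilates_le dilate_cover_diff)
  also have "\<dots> \<le> (L * L * L) * (L * L * L) * L * card S"
    using M_le L1 M_ge_1 by (intro mult_mono) auto
  also have "\<dots> = L ^ 7 * card S" by (simp add: power_numeral_reduce)
  also have "\<dots> \<le> K ^ (7 * 13 ^ J) * card S"
  proof (intro mult_right_mono)
    have "(13::nat) ^ n \<le> 13 ^ J" using n by (intro power_increasing) auto
    then have "13 ^ n * 7 \<le> 7 * (13::nat) ^ J" by simp
    then have "K ^ (13 ^ n * 7) \<le> K ^ (7 * 13 ^ J)" using K1 by (intro power_increasing)
    then show "L ^ 7 \<le> K ^ (7 * 13 ^ J)" by (simp add: L_def flip: power_mult)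
  qed simp
  finally show ?thesis .
qed

end

section \<open>Averaging over all dilates\<close>

lemma card_square_le_collisions:
  assumes "finite Q"
  shows "(card Q)\<^sup>2 \<le> card (f ` Q) * card {(x, y) \<in> Q \<times> Q. f x = f y}"
proof -
  have "card Q = (\<Sum>t\<in>f ` Q. card {q \<in> Q. f q = t})"
    using sum.group[of Q "f ` Q" f "\<lambda>_. 1::nat"] assms by simp
  then have "(real (card Q))\<^sup>2 = (\<Sum>t\<in>f ` Q. real (card {q \<in> Q. f q = t}))\<^sup>2"
    by simp
  also have "\<dots> \<le> (\<Sum>t\<in>f ` Q. (real (card {q \<in> Q. f q = t}))\<^sup>2) * card (f ` Q)"
    by (rule sum_squared_le_sum_of_squares)
  also have "(\<Sum>t\<in>f ` Q. (real (card {q \<in> Q. f q = t}))\<^sup>2)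
      = real (\<Sum>t\<in>f ` Q. card {(x, y) \<in> Q \<times> Q. f x = t \<and> f y = t})"
  proof -
    have "{(x, y) \<in> Q \<times> Q. f x = t \<and> f y = t} = {q \<in> Q. f q = t} \<times> {q \<in> Q. f q = t}" for t
      by auto
    then show ?thesis by (simp add: card_cartesian_product power2_eq_square)
  qed
  also have "(\<Sum>t\<in>f ` Q. card {(x, y) \<in> Q \<times> Q. f x = t \<and> f y = t})
      = (\<Sum>t\<in>f ` Q. card {p \<in> {(x, y) \<in> Q \<times> Q. f x = f y}. f (fst p) = t})"
    by (intro sum.cong refl arg_cong[of _ _ card]) auto
  also have "\<dots> = card {(x, y) \<in> Q \<times> Q. f x = f y}"
  proof -
    have "finite {(x, y) \<in> Q \<times> Q. f x = f y}"
      by (rule finite_subset[of _ "Q \<times> Q"]) (use assms in auto)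
    then show ?thesis
      using sum.group[of "{(x, y) \<in> Q \<times> Q. f x = f y}" "f ` Q" "\<lambda>p. f (fst p)" "\<lambda>_. 1::nat"] assms
      by (auto simp: image_subset_iff)
  qed
  finally have "real ((card Q)\<^sup>2) \<le> real (card (f ` Q) * card {(x, y) \<in> Q \<times> Q. f x = f y})"
    by (simp add: mult.commute)
  then show ?thesis by (simp only: of_nat_le_iff)
qed

text \<open>With q = |S|^2 points in S \<times> S, a sumset of size at most m forces at least q^2 /
  m collisions of x + r y, for every r. Two distinct points collide for at most one r, so summing
  over the N non-zero r leaves N q \<le> m (N + q).\<close>

lemma min_le_of_dilates_small:
  fixes S :: "'a::{field,finite} set" and m :: real
  assumes "S \<noteq> {}" and small: "\<And>r. card (S + (*) r ` S) \<le> m"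
  shows "min ((real (card S))\<^sup>2) (real CARD('a) - 1) \<le> 2 * m"
proof -
  define Q where "Q = S \<times> S"
  define q where "q = real (card Q)"
  define R where "R = UNIV - {0::'a}"
  define N where "N = real (card R)"
  define f where "f r = (\<lambda>(x, y). x + r * y)" for r :: 'a
  have N: "N = real CARD('a) - 1"
    by (simp add: N_def R_def card_Diff_subset of_nat_diff Suc_leI)
  have q: "q > 0" using assms by (simp add: q_def Q_def card_gt_0_iff)
  have m0: "m \<ge> 0" using small[of 0] by (meson of_nat_0_le_iff order_trans)
  have coll: "q\<^sup>2 \<le> m * card {(x, y) \<in> Q \<times> Q. f r x = f r y}" for r
  proof -
    have "f r ` Q = S + (*) r ` S" by (auto simp: f_def Q_def set_plus_def image_iff)
    then have "real (card (f r ` Q)) \<le> m" using small by simp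
    moreover have "real ((card Q)\<^sup>2) \<le> real (card (f r ` Q) * card {(x, y) \<in> Q \<times> Q. f r x = f r y})"
      unfolding of_nat_le_iff by (rule card_square_le_collisions) simp
    then have "q\<^sup>2 \<le> real (card (f r ` Q)) * card {(x, y) \<in> Q \<times> Q. f r x = f r y}"
      by (simp add: q_def)
    ultimately show ?thesis by (smt (verit) mult_right_mono of_nat_0_le_iff)
  qed
  have unique: "card {r \<in> R. f r x = f r y} \<le> 1" if "x \<noteq> y" for x y
  proof -
    have "r = r'" if "f r x = f r y" "f r' x = f r' y" for r r'
    proof -
      obtain x1 x2 y1 y2 where xy: "x = (x1, x2)" "y = (y1, y2)" by fastforce
      have "x1 - y1 = r * (y2 - x2)" "x1 - y1 = r' * (y2 - x2)"
        using that by (auto simp: f_def xy algebra_simps)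
      moreover from this have "y2 \<noteq> x2" using \<open>x \<noteq> y\<close> xy by auto
      ultimately show ?thesis by simp
    qed
    then show ?thesis by (simp add: card_le_Suc0_iff_eq)
  qed
  have "N * q\<^sup>2 = (\<Sum>r\<in>R. q\<^sup>2)" by (simp add: N_def)
  also have "\<dots> \<le> (\<Sum>r\<in>R. m * card {(x, y) \<in> Q \<times> Q. f r x = f r y})"
    using coll by (rule sum_mono)
  also have "\<dots> = m * (\<Sum>r\<in>R. \<Sum>p\<in>Q \<times> Q. of_bool (f r (fst p) = f r (snd p)))"
  proof -
    have "{(x, y) \<in> Q \<times> Q. f r x = f r y} = {p \<in> Q \<times> Q. f r (fst p) = f r (snd p)}" for r by auto
    then show ?thesis using card_filter_conv_sum[of "Q \<times> Q"] by (simp add: sum_distrib_left)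
  qed
  also have "\<dots> = m * (\<Sum>p\<in>Q \<times> Q. real (card {r \<in> R. f r (fst p) = f r (snd p)}))"
    by (subst sum.swap) (simp only: card_filter_conv_sum[OF finite])
  also have "\<dots> \<le> m * (\<Sum>p\<in>Q \<times> Q. N * of_bool (fst p = snd p) + 1)"
  proof (intro mult_left_mono sum_mono m0)
    fix p :: "('a \<times> 'a) \<times> ('a \<times> 'a)"
    show "real (card {r \<in> R. f r (fst p) = f r (snd p)}) \<le> N * of_bool (fst p = snd p) + 1"
      using unique[of "fst p" "snd p"] by (cases "fst p = snd p") (auto simp: N_def)
  qed
  also have "(\<Sum>p\<in>Q \<times> Q. N * of_bool (fst p = snd p) + 1) = N * q + q\<^sup>2"
  proof -
    have "{p \<in> Q \<times> Q. fst p = snd p} = (\<lambda>x. (x, x)) ` Q" by auto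
    then have "real (card {p \<in> Q \<times> Q. fst p = snd p}) = q"
      by (simp add: q_def card_image inj_on_def)
    then have "(\<Sum>p\<in>Q \<times> Q. of_bool (fst p = snd p)) = q"
      by (simp only: card_filter_conv_sum[OF finite])
    then show ?thesis
      by (simp add: sum.distrib card_cartesian_product power2_eq_square q_def
          flip: sum_distrib_left)
  qed
  finally have "q * (N * q) \<le> q * (m * (N + q))"
    by (simp add: algebra_simps power2_eq_square)
  then have main: "N * q \<le> m * (N + q)" using q by simp
  have Npos: "N \<ge> 0" by (simp add: N_def)
  have qS: "q = (real (card S))\<^sup>2"
    by (simp add: q_def Q_def card_cartesian_product power2_eq_square)
  have "min q N \<le> 2 * m"
  proof (cases "q \<le> N")
    case True
    have "N > 0" using True q by simp
    have "N * q \<le> m * (N + N)" using main True m0 by (smt (verit) mult_left_mono)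
    then have "N * q \<le> N * (2 * m)" by (simp add: algebra_simps)
    then show ?thesis using \<open>N > 0\<close> True by simp
  next
    case False
    have "q * N \<le> m * (q + q)" using main False m0 by (smt (verit) mult_left_mono mult.commute)
    then have "q * N \<le> q * (2 * m)" by (simp add: algebra_simps)
    then show ?thesis using q False by simp
  qed
  then show ?thesis by (simp add: qS N)
qed

text \<open>All dilates h B lie in A, which is at most L times as large as B, so by Cauchy-Schwarz
  two of them share |B| / L elements on average. Dividing by g turns the overlap of g B and g h B
  into that of B and h B. Overlaps below half the average contribute at most half of the
  total.\<close>

lemma many_dilates_intersect:
  fixes A B H :: "'a::{field,finite} set" and L :: real
  assumes H0: "0 \<notin> H" and Hmult: "\<And>g h. g \<in> H \<Longrightarrow> h \<in> H \<Longrightarrow> g * h \<in> H"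
    and inv: "\<And>h. h \<in> H \<Longrightarrow> (*) h ` A \<subseteq> A"
    and BA: "B \<subseteq> A" and "B \<noteq> {}" and L: "card A \<le> L * card B"
  shows "card H \<le> 2 * L * card {h \<in> H. card B \<le> 2 * L * card (B \<inter> (*) h ` B)}"
proof (cases "H = {}")
  case False
  define b where "b = real (card B)"
  define I where "I h = real (card (B \<inter> (*) h ` B))" for h
  define G where "G = {h \<in> H. b \<le> 2 * L * I h}"
  have b: "b > 0" using assms by (simp add: b_def card_gt_0_iff)
  have "0 < real (card A)" using assms by (auto simp: card_gt_0_iff)
  then have "0 < L * b" using L unfolding b_def by linarith
  then have Lpos: "L > 0" using b by (simp add: zero_less_mult_iff)
  have Hpos: "card H > 0" using False by (simp add: card_gt_0_iff)
  have card_dil: "card ((*) h ` X) = card X" if "h \<in> H" for h and X :: "'a set"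
  proof -
    have "h \<noteq> 0" using that H0 by blast
    then show ?thesis by (intro card_image) (simp add: inj_on_def)
  qed
  define c where "c x = (\<Sum>h\<in>H. of_bool (x \<in> (*) h ` B) :: real)" for x
  have sub: "(*) h ` B \<subseteq> A" if "h \<in> H" for h using inv[OF that] BA by blast
  have sumA: "(\<Sum>x\<in>A. of_bool (x \<in> X)) = real (card X)" if "X \<subseteq> A" for X
    using that by (simp add: Int_absorb1)
  have "(\<Sum>x\<in>A. c x) = (\<Sum>h\<in>H. \<Sum>x\<in>A. of_bool (x \<in> (*) h ` B))"
    unfolding c_def by (rule sum.swap)
  also have "\<dots> = (\<Sum>h\<in>H. b)"
    by (intro sum.cong refl) (simp add: sumA[OF sub] card_dil b_def del: sum_of_bool_eq)
  finally have sum1: "(\<Sum>x\<in>A. c x) = card H * b" by simp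
  have "(\<Sum>x\<in>A. (c x)\<^sup>2) = (\<Sum>x\<in>A. \<Sum>g\<in>H. \<Sum>h\<in>H. of_bool (x \<in> (*) g ` B \<inter> (*) h ` B))"
    unfolding c_def power2_eq_square sum_product by (simp only: Int_iff of_bool_conj)
  also have "\<dots> = (\<Sum>g\<in>H. \<Sum>h\<in>H. \<Sum>x\<in>A. of_bool (x \<in> (*) g ` B \<inter> (*) h ` B))"
    by (subst sum.swap, rule sum.cong[OF refl], rule sum.swap)
  also have "\<dots> = (\<Sum>g\<in>H. \<Sum>h\<in>H. real (card ((*) g ` B \<inter> (*) h ` B)))"
    by (intro sum.cong refl sumA) (use sub in blast)
  also have "\<dots> = (\<Sum>g\<in>H. \<Sum>h\<in>H. I h)"
  proof (rule sum.cong[OF refl])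
    fix g assume g: "g \<in> H"
    have g0: "g \<noteq> 0" using g H0 by blast
    \<comment> \<open>Closure under multiplication together with finiteness makes multiplication by
      g a permutation of \<open>H\<close>.\<close>
    have img: "(*) g ` H = H"
      using Hmult g g0 by (intro card_subset_eq) (auto simp: card_dil)
    have "(\<Sum>h\<in>H. real (card ((*) g ` B \<inter> (*) h ` B)))
        = (\<Sum>h\<in>(*) g ` H. real (card ((*) g ` B \<inter> (*) h ` B)))"
      by (simp only: img)
    also have "\<dots> = (\<Sum>h\<in>H. real (card ((*) g ` B \<inter> (*) (g * h) ` B)))"
      using g0 by (subst sum.reindex) (auto simp: inj_on_def)
    also have "\<dots> = (\<Sum>h\<in>H. I h)"
    proof (rule sum.cong[OF refl])
      fix h
      have "(*) g ` B \<inter> (*) (g * h) ` B = (*) g ` (B \<inter> (*) h ` B)"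
        using g0 by (subst image_Int) (auto simp: inj_on_def image_image mult.assoc)
      then show "real (card ((*) g ` B \<inter> (*) (g * h) ` B)) = I h"
        using g by (simp add: card_dil I_def)
    qed
    finally show "(\<Sum>h\<in>H. real (card ((*) g ` B \<inter> (*) h ` B))) = (\<Sum>h\<in>H. I h)" .
  qed
  also have "\<dots> = card H * (\<Sum>h\<in>H. I h)" by simp
  finally have sum2: "(\<Sum>x\<in>A. (c x)\<^sup>2) = card H * (\<Sum>h\<in>H. I h)" .
  have I0: "(\<Sum>h\<in>H. I h) \<ge> 0" by (intro sum_nonneg) (simp add: I_def)
  have "(card H * b)\<^sup>2 \<le> (card H * (\<Sum>h\<in>H. I h)) * card A"
    using sum_squared_le_sum_of_squares[of c A] by (simp only: sum1 sum2)
  also have "\<dots> \<le> (card H * (\<Sum>h\<in>H. I h)) * (L * b)"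
    using L I0 by (intro mult_left_mono) (auto simp: b_def)
  finally have "(card H * b) * (card H * b) \<le> (card H * b) * (L * (\<Sum>h\<in>H. I h))"
    by (simp add: power2_eq_square algebra_simps)
  then have le1: "card H * b \<le> L * (\<Sum>h\<in>H. I h)"
    using b Hpos by simp
  have "(\<Sum>h\<in>H. I h) = (\<Sum>h\<in>G. I h) + (\<Sum>h\<in>H - G. I h)"
    by (subst sum.subset_diff[of G H]) (auto simp: G_def)
  also have "\<dots> \<le> (\<Sum>h\<in>G. b) + (\<Sum>h\<in>H - G. b / (2 * L))"
  proof (intro add_mono sum_mono)
    fix h show "I h \<le> b" by (simp add: I_def b_def card_mono)
  next
    fix h assume "h \<in> H - G"
    then show "I h \<le> b / (2 * L)" using Lpos by (auto simp: G_def field_simps)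
  qed
  also have "\<dots> \<le> card G * b + card H * (b / (2 * L))"
    using b Lpos by (auto intro!: mult_right_mono card_mono divide_right_mono)
  finally have "L * (\<Sum>h\<in>H. I h) \<le> L * (card G * b + card H * (b / (2 * L)))"
    using Lpos by (intro mult_left_mono) auto
  also have "\<dots> = b * (L * card G + card H / 2)"
    using Lpos by (simp add: field_simps)
  finally have "b * card H \<le> b * (L * card G + card H / 2)" using le1 by (simp add: mult.commute)
  then have "card H \<le> L * card G + card H / 2" using b by simp
  then have "card H \<le> 2 * L * card G" by simp
  then show ?thesis by (simp add: G_def b_def I_def)
qed simp

section \<open>Sets invariant under a multiplicative group\<close>

theorem invariant_set_dichotomy:
  fixes A D H :: "'a::{field,finite} set" and K :: real
  assumes prime_field: "\<And>x::'a. \<exists>n. x = of_nat n"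
    and H0: "0 \<notin> H" and Hmult: "\<And>g h. g \<in> H \<Longrightarrow> h \<in> H \<Longrightarrow> g * h \<in> H"
    and inv: "\<And>h. h \<in> H \<Longrightarrow> (*) h ` A \<subseteq> A"
    and "A \<noteq> {}" and K: "K \<ge> 2"
    and symD: "uminus ` D = D"
    and dense: "(card A)\<^sup>2 \<le> K * card {(a, b) \<in> A \<times> A. a - b \<in> D}"
    and D: "card D \<le> K * card A"
    and big: "CARD('a) < (card H / K ^ 4) ^ (2 ^ J)"
  shows "card A \<le> K ^ (833 * 13 ^ J + 22) \<or> CARD('a) \<le> K ^ (833 * 13 ^ J + 22) * card A"
proof -
  have two_pow: "2 ^ n \<le> K ^ n" for n using K by (intro power_mono) auto
  have K0: "K > 0" using K by simp
  obtain B where B: "B \<subseteq> A" "card A \<le> 4 * K * card B"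
    and dbl: "card (B + uminus ` B) \<le> 1600 * K ^ 9 * card A"
    using balog_szemeredi_gowers[of A D K] assms K0 by auto
  define b where "b = real (card B)"
  have "0 < real (card A)" using \<open>A \<noteq> {}\<close> by (simp add: card_gt_0_iff)
  then have "0 < b" using B(2) K0 unfolding b_def by (metis mult_zero_right not_less of_nat_0_le_iff order_le_less)
  then have Bne: "B \<noteq> {}" by (auto simp: b_def)
  define S where "S = B + uminus ` B"
  \<comment> \<open>The exponent is 115 + 4: \<open>pluennecke_diff\<close> at doubling constant
    K^23 gives 5 * 23 = 115, and passing from B to its intersection with h B costs 8 K \<le>
    K^4.\<close>
  define M where "M = K ^ 119"
  have S_ne: "S \<noteq> {}" using Bne by (auto simp: S_def set_plus_def)
  have S_sym: "uminus ` S = S"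
    by (simp add: S_def image_uminus_set_plus image_image add.commute)
  have "real (card S) \<le> 1600 * K ^ 9 * (4 * K * b)"
    using dbl B(2) K0 unfolding S_def b_def by (smt (verit) mult_left_mono zero_le_power)
  also have "\<dots> = 6400 * (K ^ 10 * b)" by (simp add: power_numeral_reduce)
  \<comment> \<open>Numerical constants become powers of K because K \<ge> 2; here 6400 \<le>
    2^13.\<close>
  also have "\<dots> \<le> K ^ 13 * (K ^ 10 * b)"
    using two_pow[of 13] K0 \<open>0 < b\<close> by (intro mult_right_mono) auto
  finally have "real (card (B + uminus ` B)) \<le> K ^ 23 * card B"
    by (simp add: S_def b_def flip: power_add mult.assoc)
  then have "real (card (B + B + B + uminus ` (B + B))) \<le> (K ^ 23) ^ 5 * card B"
    by (intro pluennecke_diff) (use Bne in auto)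
  then have plu: "real (card (B + B + B + uminus ` (B + B))) \<le> K ^ 115 * b"
    by (simp add: b_def flip: power_mult)
  have cover: "\<exists>Z. card Z \<le> M \<and> S + S \<subseteq> Z + S"
  proof -
    obtain X where X: "card X * card B \<le> card (S + S + B)" "S + S \<subseteq> X + (B + uminus ` B)"
      by (rule ruzsa_covering[OF finite Bne finite])
    have "S + S + B = B + B + B + uminus ` (B + B)"
      by (simp add: S_def image_uminus_set_plus ac_simps)
    then have "real (card X) * b \<le> K ^ 115 * b"
      using X(1) plu unfolding b_def by (metis of_nat_le_iff of_nat_mult order_trans)
    then have "real (card X) \<le> K ^ 115" using \<open>0 < b\<close> by simp
    also have "\<dots> \<le> M" unfolding M_def using K by (intro power_increasing) auto
    finally show ?thesis using X by (auto simp: S_def)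
  qed
  interpret approximate_subgroup S M
    using S_ne S_sym cover by unfold_locales
  define T where "T = {t. dilate_cover S M t}"
  have K8: "8 * K \<le> K ^ 4"
  proof -
    have "8 * K \<le> K ^ 3 * K" using two_pow[of 3] K0 by (intro mult_right_mono) auto
    then show ?thesis by (simp add: power_numeral_reduce)
  qed
  have cover_H: "h \<in> T" if h: "h \<in> H" "card B \<le> 2 * (4 * K) * card (B \<inter> (*) h ` B)" for h
  proof -
    \<comment> \<open>Cover h S by translates of C - C. Since C \<subseteq> h B, the set h S + C
      lies in the dilate h (S + B) of a small set; since C \<subseteq> B, the differences fall back
      into S.\<close>
    define C where "C = B \<inter> (*) h ` B"
    have bC: "b \<le> K ^ 4 * card C"
      using h(2) K8 unfolding b_def C_def by (smt (verit) mult_right_mono of_nat_0_le_iff)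
    have "real (card C) \<noteq> 0" using bC \<open>0 < b\<close> by (metis mult_zero_right not_less)
    then have Cpos: "real (card C) > 0" by linarith
    then have "C \<noteq> {}" by auto
    obtain X where X: "card X * card C \<le> card ((*) h ` S + C)"
      "(*) h ` S \<subseteq> X + (C + uminus ` C)"
      by (rule ruzsa_covering[OF finite \<open>C \<noteq> {}\<close> finite])
    have "card ((*) h ` S + C) \<le> card ((*) h ` S + (*) h ` B)"
      by (intro card_mono set_plus_mono2) (auto simp: C_def)
    also have "\<dots> = card ((*) h ` (S + B))" by (simp only: image_mult_set_plus)
    also have "\<dots> \<le> card (S + B)" by (rule card_image_le) simp
    also have "\<dots> \<le> card (S + B + S)" by (rule card_le_card_set_plus) (use S_ne in auto)
    also have "S + B + S = B + B + B + uminus ` (B + B)"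
      by (simp add: S_def image_uminus_set_plus ac_simps)
    finally have "real (card X) * card C \<le> K ^ 115 * b"
      using X(1) plu by (metis of_nat_le_iff of_nat_mult order_trans)
    also have "\<dots> \<le> K ^ 115 * (K ^ 4 * card C)"
      using bC K0 by (intro mult_left_mono) auto
    also have "\<dots> = M * card C" by (simp add: M_def flip: power_add mult.assoc)
    finally have "real (card X) \<le> M" using Cpos by simp
    moreover have "(*) h ` S \<subseteq> X + S"
    proof -
      have "C + uminus ` C \<subseteq> S" unfolding S_def C_def by (intro set_plus_mono2) auto
      then have "X + (C + uminus ` C) \<subseteq> X + S" by (rule set_plus_mono2[OF order_refl])
      then show ?thesis using X(2) by (rule subset_trans[rotated])
    qed
    ultimately show ?thesis unfolding T_def dilate_cover_def by auto
  qed
  have "card H \<le> 2 * (4 * K) * card {h \<in> H. card B \<le> 2 * (4 * K) * card (B \<inter> (*) h ` B)}"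
    using many_dilates_intersect[OF H0 Hmult inv B(1) Bne B(2)] by blast
  also have "\<dots> \<le> 2 * (4 * K) * card T"
    using cover_H K0 by (intro mult_left_mono) (auto intro!: card_mono)
  also have "\<dots> \<le> K ^ 4 * card T" using K8 by (simp add: mult_right_mono)
  finally have HT: "card H / K ^ 4 \<le> card T" using K0 by (simp add: field_simps)
  have "real CARD('a) < (card H / K ^ 4) ^ (2 ^ J)" by (rule big)
  also have "\<dots> \<le> (real (card T)) ^ (2 ^ J)" using HT K0 by (intro power_mono) auto
  finally have big': "CARD('a) < card T ^ (2 ^ J)"
    by (metis of_nat_less_iff of_nat_power)
  have T2: "2 \<le> card T"
  proof (rule ccontr)
    assume "\<not> 2 \<le> card T"
    then have "card T ^ (2 ^ J) \<le> 1 ^ (2 ^ J)" by (intro power_mono) auto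
    then show False using big' zero_less_card_finite[where 'a = 'a] by simp
  qed
  define Q :: nat where "Q = 833 * 13 ^ J"
  have "M ^ (7 * 13 ^ J) = K ^ (119 * (7 * 13 ^ J))"
    unfolding M_def by (rule power_mult[symmetric])
  also have "119 * (7 * 13 ^ J) = Q" by (simp add: Q_def)
  finally have MQ: "M ^ (7 * 13 ^ J) = K ^ Q" .
  have "card (S + (*) r ` S) \<le> K ^ Q * card S" for r
    using card_set_plus_dilate_le[OF prime_field order_refl, of J r] T2 big'
    by (simp add: T_def MQ)
  then have "min ((real (card S))\<^sup>2) (real CARD('a) - 1) \<le> 2 * (K ^ Q * card S)"
    by (intro min_le_of_dilates_small S_ne)
  moreover have AS: "card A \<le> 4 * K * card S"
  proof -
    have "card B \<le> card S" unfolding S_def by (rule card_le_card_set_plus) (use Bne in auto)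
    then show ?thesis using B(2) K0 by (smt (verit) mult_left_mono of_nat_mono)
  qed
  \<comment> \<open>S is either tiny or almost as large as the field, and both pass to A because |A|
    and |S| agree up to powers of K. The 22 in the exponent is 9 + 13 from the second case; the
    first needs only 4.\<close>
  ultimately consider "(real (card S))\<^sup>2 \<le> 2 * (K ^ Q * card S)"
    | "real CARD('a) - 1 \<le> 2 * (K ^ Q * card S)"
    by linarith
  then show ?thesis
  proof cases
    case 1
    have "real (card S) > 0" using S_ne by (simp add: card_gt_0_iff)
    moreover have "real (card S) * card S \<le> (2 * K ^ Q) * card S"
      using 1 by (simp add: power2_eq_square algebra_simps)
    ultimately have "real (card S) \<le> 2 * K ^ Q" by simp
    then have "4 * K * card S \<le> 4 * K * (2 * K ^ Q)" using K0 by (intro mult_left_mono) auto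
    then have "real (card A) \<le> 8 * K * K ^ Q" using AS by simp
    also have "\<dots> \<le> K ^ 4 * K ^ Q" using K8 K0 by (intro mult_right_mono) auto
    also have "\<dots> = K ^ (Q + 4)" by (simp add: power_add)
    also have "\<dots> \<le> K ^ (Q + 22)" using K by (intro power_increasing) auto
    finally show ?thesis by (simp add: Q_def)
  next
    case 2
    have "2 \<le> CARD('a)" using card_mono[of UNIV "{0, 1::'a}"] by simp
    then have "real CARD('a) \<le> 2 * (real CARD('a) - 1)" by simp
    also have "\<dots> \<le> 2 * (2 * (K ^ Q * card S))" using 2 by simp
    also have "\<dots> \<le> 2 * (2 * (K ^ Q * (1600 * K ^ 9 * card A)))"
      using dbl K0 unfolding S_def by (intro mult_left_mono) auto
    also have "\<dots> = 6400 * (K ^ (Q + 9) * card A)" by (simp add: power_add)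
    also have "\<dots> \<le> K ^ 13 * (K ^ (Q + 9) * card A)"
      using two_pow[of 13] K0 by (intro mult_right_mono) auto
    also have "\<dots> = K ^ (Q + 22) * card A"
      by (simp add: add.commute flip: power_add mult.assoc)
    finally show ?thesis by (simp add: Q_def)
  qed
qed

section \<open>The large spectrum\<close>

locale additive_character =
  fixes e :: "'a::{field,finite} \<Rightarrow> complex"
  assumes add: "e (x + y) = e x * e y"
    and norm: "cmod (e x) = 1"
    and nontrivial: "\<exists>x. e x \<noteq> 1"
begin

definition spec :: "'a set \<Rightarrow> 'a \<Rightarrow> real" where
  "spec H \<xi> = cmod (\<Sum>x\<in>H. e (x * \<xi>)) / card H"

definition large_spectrum :: "'a set \<Rightarrow> real \<Rightarrow> 'a set" where
  "large_spectrum H \<rho> = {\<xi>. \<rho> \<le> spec H \<xi>}"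

lemma zero: "e 0 = 1"
proof -
  have "e 0 * e 0 = e 0 * 1" using add[of 0 0] by simp
  moreover have "e 0 \<noteq> 0" using norm[of 0] by auto
  ultimately show ?thesis by simp
qed

lemma uminus: "e (- x) = cnj (e x)"
proof -
  have "e x * e (- x) = e x * cnj (e x)"
    using add[of x "- x"] zero norm[of x] complex_norm_square[of "e x"] by simp
  moreover have "e x \<noteq> 0" using norm[of x] by auto
  ultimately show ?thesis by simp
qed

lemma diff: "e (x - y) = e x * cnj (e y)"
  using add[of x "- y"] by (simp add: uminus)

lemma sum_UNIV:
  assumes "t \<noteq> 0"
  shows "(\<Sum>\<xi>\<in>UNIV. e (t * \<xi>)) = 0"
proof -
  obtain x where x: "e x \<noteq> 1" using nontrivial by blast
  have "(\<Sum>\<xi>\<in>UNIV. e (t * \<xi>)) = (\<Sum>\<xi>\<in>UNIV. e (t * (\<xi> + x / t)))"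
    by (rule sum.reindex_bij_witness[of _ "\<lambda>\<xi>. \<xi> + x / t" "\<lambda>\<xi>. \<xi> - x / t"]) auto
  also have "\<dots> = (\<Sum>\<xi>\<in>UNIV. e (t * \<xi>)) * e x"
    using assms by (simp add: distrib_left add sum_distrib_right)
  finally have "(\<Sum>\<xi>\<in>UNIV. e (t * \<xi>)) * (e x - 1) = 0" by (simp add: algebra_simps)
  then show ?thesis using x by simp
qed

lemma cmod_sum_square:
  "complex_of_real ((cmod (\<Sum>x\<in>X. c x))\<^sup>2) = (\<Sum>x\<in>X. \<Sum>y\<in>X. c x * cnj (c y))"
  by (simp only: complex_norm_square cnj_sum sum_product)

lemma parseval:
  "(\<Sum>\<xi>\<in>UNIV. (cmod (\<Sum>x\<in>H. e (x * \<xi>)))\<^sup>2) = real CARD('a) * card H"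
proof -
  have "complex_of_real (\<Sum>\<xi>\<in>UNIV. (cmod (\<Sum>x\<in>H. e (x * \<xi>)))\<^sup>2)
      = (\<Sum>\<xi>\<in>UNIV. \<Sum>x\<in>H. \<Sum>y\<in>H. e (x * \<xi>) * cnj (e (y * \<xi>)))"
    by (simp add: cmod_sum_square del: of_real_power)
  also have "\<dots> = (\<Sum>x\<in>H. \<Sum>\<xi>\<in>UNIV. \<Sum>y\<in>H. e (x * \<xi>) * cnj (e (y * \<xi>)))"
    by (rule sum.swap)
  also have "\<dots> = (\<Sum>x\<in>H. \<Sum>y\<in>H. \<Sum>\<xi>\<in>UNIV. e (x * \<xi>) * cnj (e (y * \<xi>)))"
    by (rule sum.cong[OF refl], rule sum.swap)
  also have "\<dots> = (\<Sum>x\<in>H. \<Sum>y\<in>H. \<Sum>\<xi>\<in>UNIV. e ((x - y) * \<xi>))"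
    by (simp add: diff left_diff_distrib)
  also have "\<dots> = (\<Sum>x\<in>H. \<Sum>y\<in>H. if x = y then of_nat CARD('a) else 0)"
    by (intro sum.cong refl) (auto simp: sum_UNIV zero)
  also have "\<dots> = complex_of_real (real CARD('a) * card H)" by simp
  finally show ?thesis by (simp only: of_real_eq_iff)
qed

text \<open>By \<open>parseval\<close> the squared sums total p |H|, and each point of the level set
  contributes at least (\<rho> |H|)^2. This is what keeps level sets well below the size of the
  field.\<close>

lemma card_large_spectrum_le:
  fixes \<rho> :: real
  assumes "H \<noteq> {}" "\<rho> \<ge> 0"
  shows "card (large_spectrum H \<rho>) * \<rho>\<^sup>2 * card H \<le> CARD('a)"
proof -
  have pos: "real (card H) > 0" using assms by (simp add: card_gt_0_iff)
  have "card (large_spectrum H \<rho>) * (\<rho> * card H)\<^sup>2 = (\<Sum>\<xi>\<in>large_spectrum H \<rho>. (\<rho> * card H)\<^sup>2)"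
    by simp
  also have "\<dots> \<le> (\<Sum>\<xi>\<in>large_spectrum H \<rho>. (cmod (\<Sum>x\<in>H. e (x * \<xi>)))\<^sup>2)"
    using assms pos
    by (intro sum_mono power_mono) (auto simp: large_spectrum_def spec_def field_simps)
  also have "\<dots> \<le> (\<Sum>\<xi>\<in>UNIV. (cmod (\<Sum>x\<in>H. e (x * \<xi>)))\<^sup>2)"
    by (intro sum_mono2) auto
  finally have "(card (large_spectrum H \<rho>) * \<rho>\<^sup>2 * card H) * card H \<le> real CARD('a) * card H"
    unfolding parseval by (simp add: power2_eq_square algebra_simps)
  then show ?thesis using pos by simp
qed

lemma spec_le_1: "spec H \<xi> \<le> 1"
proof -
  have "cmod (\<Sum>x\<in>H. e (x * \<xi>)) \<le> (\<Sum>x\<in>H. 1)"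
    by (intro sum_norm_le) (simp add: norm)
  then show ?thesis by (simp add: spec_def divide_le_eq_1 card_gt_0_iff)
qed

lemma spec_0: "H \<noteq> {} \<Longrightarrow> spec H 0 = 1"
  by (simp add: spec_def zero)

lemma spec_uminus: "spec H (- \<xi>) = spec H \<xi>"
proof -
  have "(\<Sum>x\<in>H. e (x * (- \<xi>))) = cnj (\<Sum>x\<in>H. e (x * \<xi>))" by (simp add: uminus)
  then show ?thesis by (simp only: spec_def complex_mod_cnj)
qed

lemma uminus_large_spectrum: "uminus ` large_spectrum H \<rho> = large_spectrum H \<rho>"
proof -
  have sub: "uminus ` large_spectrum H \<rho> \<subseteq> large_spectrum H \<rho>"
    by (auto simp: large_spectrum_def spec_uminus)
  then have "uminus ` uminus ` large_spectrum H \<rho> \<subseteq> uminus ` large_spectrum H \<rho>"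
    by (rule image_mono)
  then show ?thesis using sub by (simp add: image_image)
qed

lemma spec_mult:
  assumes "0 \<notin> H" "\<And>g h. g \<in> H \<Longrightarrow> h \<in> H \<Longrightarrow> g * h \<in> H" "h \<in> H"
  shows "spec H (h * \<xi>) = spec H \<xi>"
proof -
  have "h \<noteq> 0" using assms by blast
  then have inj: "inj_on ((*) h) H" by (simp add: inj_on_def)
  have img: "(*) h ` H = H"
    using assms by (intro card_subset_eq) (auto simp: card_image[OF inj])
  have "(\<Sum>x\<in>H. e (x * \<xi>)) = (\<Sum>x\<in>(*) h ` H. e (x * \<xi>))" by (simp only: img)
  also have "\<dots> = (\<Sum>x\<in>H. e (x * (h * \<xi>)))"
    using inj by (subst sum.reindex) (simp_all add: ac_simps)
  finally show ?thesis by (simp add: spec_def)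
qed

text \<open>The large spectrum is additively rich: writing \<open>spec H a = u a * (\<Sum>x\<in>H. e (x * a)) / card H\<close>
  with unimodular \<open>u a\<close>, Cauchy--Schwarz in \<open>x\<close> bounds the square of \<open>\<Sum>a\<in>A. spec H a\<close> by
  \<open>\<Sum>a\<in>A. \<Sum>b\<in>A. spec H (a - b)\<close>.\<close>

lemma sum_spec_square_le:
  assumes "H \<noteq> {}"
  shows "(\<Sum>a\<in>A. spec H a)\<^sup>2 \<le> (\<Sum>a\<in>A. \<Sum>b\<in>A. spec H (a - b))"
proof -
  define n where "n = real (card H)"
  have n: "n > 0" using assms by (simp add: n_def card_gt_0_iff)
  define f where "f a = (\<Sum>x\<in>H. e (x * a))" for a
  define u where "u a = (if f a = 0 then 1 else cnj (f a) / cmod (f a))" for a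
  have u: "cmod (u a) = 1" for a by (simp add: u_def norm_divide)
  have uf: "u a * f a = cmod (f a)" for a
    by (auto simp: u_def complex_norm_square[symmetric] power2_eq_square mult.commute)
  have spec: "spec H a = cmod (f a) / n" for a by (simp add: spec_def f_def n_def)
  define g where "g x = (\<Sum>a\<in>A. u a * e (x * a))" for x
  have "complex_of_real (\<Sum>a\<in>A. cmod (f a)) = (\<Sum>a\<in>A. u a * f a)" by (simp add: uf)
  also have "\<dots> = (\<Sum>x\<in>H. g x)"
    unfolding g_def f_def by (subst sum.swap) (simp add: sum_distrib_left)
  finally have eq1: "complex_of_real (\<Sum>a\<in>A. cmod (f a)) = (\<Sum>x\<in>H. g x)" .
  have "(\<Sum>a\<in>A. cmod (f a)) = cmod (complex_of_real (\<Sum>a\<in>A. cmod (f a)))"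
    unfolding norm_of_real by (simp add: sum_nonneg)
  also have "\<dots> \<le> (\<Sum>x\<in>H. cmod (g x))" unfolding eq1 by (rule norm_sum)
  finally have "(\<Sum>a\<in>A. cmod (f a))\<^sup>2 \<le> (\<Sum>x\<in>H. cmod (g x))\<^sup>2"
    by (intro power_mono) (auto intro: sum_nonneg)
  also have "\<dots> \<le> (\<Sum>x\<in>H. (cmod (g x))\<^sup>2) * n"
    unfolding n_def by (rule sum_squared_le_sum_of_squares)
  also have "(\<Sum>x\<in>H. (cmod (g x))\<^sup>2) \<le> (\<Sum>a\<in>A. \<Sum>b\<in>A. cmod (f (a - b)))"
  proof -
    have "complex_of_real (\<Sum>x\<in>H. (cmod (g x))\<^sup>2)
        = (\<Sum>x\<in>H. \<Sum>a\<in>A. \<Sum>b\<in>A. (u a * e (x * a)) * cnj (u b * e (x * b)))"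
      by (simp only: of_real_sum g_def cmod_sum_square)
    also have "\<dots> = (\<Sum>a\<in>A. \<Sum>x\<in>H. \<Sum>b\<in>A. (u a * e (x * a)) * cnj (u b * e (x * b)))"
      by (rule sum.swap)
    also have "\<dots> = (\<Sum>a\<in>A. \<Sum>b\<in>A. \<Sum>x\<in>H. (u a * e (x * a)) * cnj (u b * e (x * b)))"
      by (rule sum.cong[OF refl], rule sum.swap)
    also have "\<dots> = (\<Sum>a\<in>A. \<Sum>b\<in>A. u a * cnj (u b) * f (a - b))"
      by (simp add: f_def sum_distrib_left right_diff_distrib diff mult_ac)
    finally have eq: "complex_of_real (\<Sum>x\<in>H. (cmod (g x))\<^sup>2)
        = (\<Sum>a\<in>A. \<Sum>b\<in>A. u a * cnj (u b) * f (a - b))" .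
    have "(\<Sum>x\<in>H. (cmod (g x))\<^sup>2) = cmod (complex_of_real (\<Sum>x\<in>H. (cmod (g x))\<^sup>2))"
      unfolding norm_of_real by (simp add: sum_nonneg)
    also have "\<dots> \<le> (\<Sum>a\<in>A. \<Sum>b\<in>A. cmod (f (a - b)))"
      unfolding eq
      by (intro sum_norm_le order_trans[OF norm_sum] sum_mono) (simp add: norm_mult u)
    finally show ?thesis .
  qed
  finally have "(\<Sum>a\<in>A. cmod (f a))\<^sup>2 \<le> (\<Sum>a\<in>A. \<Sum>b\<in>A. cmod (f (a - b))) * n"
    using n by (simp add: mult_right_mono)
  then have "(\<Sum>a\<in>A. cmod (f a))\<^sup>2 / n\<^sup>2 \<le> (\<Sum>a\<in>A. \<Sum>b\<in>A. cmod (f (a - b))) / n"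
    using n by (simp add: field_simps power2_eq_square)
  then show ?thesis by (simp add: spec power_divide flip: sum_divide_distrib)
qed

text \<open>By \<open>sum_spec_square_le\<close> the mean of \<open>spec H (a - b)\<close> over the
  pairs is at least \<rho>^2. Differences outside the next level account for at most \<rho>^2 / 2 of
  it, and each of the others for at most 1.\<close>

lemma large_spectrum_differences:
  fixes \<rho> :: real
  assumes "H \<noteq> {}" "\<rho> \<ge> 0"
  defines "A \<equiv> large_spectrum H \<rho>"
  shows "\<rho>\<^sup>2 / 2 * (card A)\<^sup>2 \<le> card {(a, b) \<in> A \<times> A. a - b \<in> large_spectrum H (\<rho>\<^sup>2 / 2)}"
proof -
  define D where "D = large_spectrum H (\<rho>\<^sup>2 / 2)"
  have "\<rho> * card A = (\<Sum>a\<in>A. \<rho>)" by simp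
  also have "\<dots> \<le> (\<Sum>a\<in>A. spec H a)"
    by (intro sum_mono) (simp add: A_def large_spectrum_def)
  finally have "(\<rho> * card A)\<^sup>2 \<le> (\<Sum>a\<in>A. spec H a)\<^sup>2"
    using assms by (intro power_mono) auto
  also have "\<dots> \<le> (\<Sum>a\<in>A. \<Sum>b\<in>A. spec H (a - b))"
    by (rule sum_spec_square_le[OF assms(1)])
  also have "\<dots> = (\<Sum>p\<in>A \<times> A. spec H (fst p - snd p))"
    by (simp add: sum.cartesian_product case_prod_unfold)
  also have "\<dots> \<le> (\<Sum>p\<in>A \<times> A. of_bool (fst p - snd p \<in> D) + \<rho>\<^sup>2 / 2)"
  proof (rule sum_mono)
    fix p :: "'a \<times> 'a"
    show "spec H (fst p - snd p) \<le> of_bool (fst p - snd p \<in> D) + \<rho>\<^sup>2 / 2"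
      using spec_le_1[of H "fst p - snd p"]
      by (cases "fst p - snd p \<in> D") (auto simp: D_def large_spectrum_def intro: add_increasing2)
  qed
  also have "\<dots> = card {p \<in> A \<times> A. fst p - snd p \<in> D} + \<rho>\<^sup>2 / 2 * (card A)\<^sup>2"
    by (subst card_filter_conv_sum)
       (simp_all add: sum.distrib card_cartesian_product power2_eq_square)
  also have "{p \<in> A \<times> A. fst p - snd p \<in> D} = {(a, b) \<in> A \<times> A. a - b \<in> D}" by auto
  finally show ?thesis by (simp add: D_def power_mult_distrib)
qed

lemma exists_slow_growth:
  fixes K :: real and \<rho> :: "nat \<Rightarrow> real"
  assumes "H \<noteq> {}" "K > 0" "I > 0" and \<rho>: "\<And>j. \<rho> j \<le> 1" and "CARD('a) \<le> K ^ I"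
  obtains j where "j < I" "card (large_spectrum H (\<rho> (Suc j))) \<le> K * card (large_spectrum H (\<rho> j))"
proof -
  define c where "c j = real (card (large_spectrum H (\<rho> j)))" for j
  have "0 \<in> large_spectrum H (\<rho> 0)" using spec_0 \<rho> assms by (simp add: large_spectrum_def)
  then have c0: "c 0 \<ge> 1" by (auto simp: c_def Suc_le_eq card_gt_0_iff)
  have "\<exists>j<I. c (Suc j) \<le> K * c j"
  proof (rule ccontr)
    assume neg: "\<not> ?thesis"
    \<comment> \<open>Strict inequality after the first step is carried along because K^I may equal
      the size of the field.\<close>
    have "j \<le> I \<Longrightarrow> K ^ j \<le> c j \<and> (j > 0 \<longrightarrow> K ^ j < c j)" for j
    proof (induction j)
      case (Suc j)
      have "K ^ Suc j \<le> K * c j" using Suc assms by simp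
      also have "\<dots> < c (Suc j)" using neg Suc by (auto simp: not_le)
      finally show ?case by simp
    qed (use c0 in simp)
    then have "K ^ I < c I" using assms by simp
    also have "c I \<le> CARD('a)" by (simp add: c_def card_mono)
    finally show False using assms by simp
  qed
  then show ?thesis using that by (auto simp: c_def)
qed

theorem spec_lt:
  fixes K \<rho> :: real
  assumes prime_field: "\<And>x::'a. \<exists>n. x = of_nat n"
    and H0: "0 \<notin> H" and Hmult: "\<And>g h. g \<in> H \<Longrightarrow> h \<in> H \<Longrightarrow> g * h \<in> H"
    and K: "K \<ge> 2" and I: "I > 0" "CARD('a) \<le> K ^ I"
    and big: "CARD('a) < (card H / K ^ 4) ^ (2 ^ J)"
    and card_H: "K ^ (833 * 13 ^ J + 23) < card H"
    and \<rho>: "0 < \<rho>" "\<rho> \<le> 1" "1 \<le> K * (\<rho> / 2) ^ (2 ^ I)"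
    and "\<xi> \<noteq> 0"
  shows "spec H \<xi> < \<rho>"
proof (rule ccontr)
  assume "\<not> spec H \<xi> < \<rho>"
  then have \<xi>: "\<rho> \<le> spec H \<xi>" by simp
  define E :: nat where "E = 833 * 13 ^ J + 22"
  have "0 < real (card H)" using card_H K by (smt (verit) zero_less_power)
  then have H: "H \<noteq> {}" by auto
  have K0: "K > 0" using K by simp
  \<comment> \<open>The solution of r (j + 1) = (r j)^2 / 2 with r 0 = \<rho>, the passage between
    thresholds in \<open>large_spectrum_differences\<close>.\<close>
  define r where "r j = 2 * (\<rho> / 2) ^ (2 ^ j)" for j
  have r_Suc: "r (Suc j) = (r j)\<^sup>2 / 2" for j
    unfolding r_def power_Suc[of "2::nat"] power_even_eq by (simp add: power_mult_distrib)
  have r_pos: "r j > 0" for j using \<rho> by (simp add: r_def)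
  have r_le: "r j \<le> \<rho>" for j
  proof -
    have "(\<rho> / 2) ^ (2 ^ j) \<le> (\<rho> / 2) ^ 1" using \<rho> by (intro power_decreasing) auto
    then show ?thesis by (simp add: r_def)
  qed
  have r_le_1: "r j \<le> 1" for j using r_le[of j] \<rho> by simp
  obtain j where j: "j < I"
    "card (large_spectrum H (r (Suc j))) \<le> K * card (large_spectrum H (r j))"
    by (rule exists_slow_growth[of H K I r, OF H K0 I(1) r_le_1 I(2)])
  have Kr: "1 \<le> K * r (Suc j)"
  proof -
    have "(\<rho> / 2) ^ (2 ^ I) \<le> (\<rho> / 2) ^ (2 ^ Suc j)"
      using \<rho> j by (intro power_decreasing power_increasing) auto
    also have "\<dots> \<le> r (Suc j)" using \<rho> by (simp add: r_def)
    finally have "K * (\<rho> / 2) ^ (2 ^ I) \<le> K * r (Suc j)" using K by (intro mult_left_mono) auto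
    then show ?thesis using \<rho> by simp
  qed
  define A where "A = large_spectrum H (r j)"
  define D where "D = large_spectrum H (r (Suc j))"
  have inv: "(*) h ` A \<subseteq> A" if "h \<in> H" for h
    using spec_mult[OF H0 Hmult that] by (auto simp: A_def large_spectrum_def)
  have Ane: "A \<noteq> {}"
  proof -
    have "0 \<in> A" using spec_0[OF H] r_le_1[of j] by (simp add: A_def large_spectrum_def)
    then show ?thesis by blast
  qed
  have "1 * real ((card A)\<^sup>2) \<le> (K * r (Suc j)) * (card A)\<^sup>2"
    using Kr by (intro mult_right_mono) auto
  also have "\<dots> = K * ((r j)\<^sup>2 / 2 * (card A)\<^sup>2)" by (simp add: r_Suc)
  also have "\<dots> \<le> K * card {(a, b) \<in> A \<times> A. a - b \<in> D}"
    unfolding A_def D_def r_Suc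
    using large_spectrum_differences[OF H, of "r j"] r_pos[of j] K by (intro mult_left_mono) auto
  finally have dense: "(card A)\<^sup>2 \<le> K * card {(a, b) \<in> A \<times> A. a - b \<in> D}" by simp
  have "card A \<le> K ^ E \<or> CARD('a) \<le> K ^ E * card A"
    unfolding E_def
    by (rule invariant_set_dichotomy[OF prime_field H0 Hmult inv Ane K _ dense _ big])
       (use j in \<open>auto simp: D_def A_def uminus_large_spectrum\<close>)
  \<comment> \<open>The first alternative fails because A contains the orbit of the non-zero \<xi>
    under H.\<close>
  moreover have "K ^ E < card A"
  proof -
    have "\<xi> \<in> A" using \<xi> r_le[of j] by (simp add: A_def large_spectrum_def)
    then have "(\<lambda>h. h * \<xi>) ` H \<subseteq> A" using inv by auto
    then have "card ((\<lambda>h. h * \<xi>) ` H) \<le> card A" by (intro card_mono) auto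
    moreover have "card ((\<lambda>h. h * \<xi>) ` H) = card H"
      using \<open>\<xi> \<noteq> 0\<close> by (intro card_image) (simp add: inj_on_def)
    moreover have "K ^ E \<le> K ^ (833 * 13 ^ J + 23)"
      unfolding E_def using K by (intro power_increasing) auto
    ultimately show ?thesis using card_H by linarith
  qed
  \<comment> \<open>The second alternative fails by Parseval: |A| (r j)^2 |H| \<le> p, where (r j)^2
    = 2 r (j + 1) \<ge> 2 / K and |H| > K^(E + 1).\<close>
  moreover have "K ^ E * card A < CARD('a)"
  proof -
    have "(K ^ E * card A) * 1 \<le> (K ^ E * card A) * (K * r (Suc j))"
      using Kr K by (intro mult_left_mono) auto
    also have "\<dots> = card A * (r j)\<^sup>2 * (K ^ Suc E / 2)" by (simp add: r_Suc)
    also have "\<dots> < card A * (r j)\<^sup>2 * card H"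
    proof (rule mult_strict_left_mono)
      have "K ^ Suc E / 2 \<le> K ^ Suc E" using K by simp
      also have "K ^ Suc E = K ^ (833 * 13 ^ J + 23)" by (simp add: E_def add.commute)
      finally show "K ^ Suc E / 2 < card H" using card_H by linarith
      show "0 < card A * (r j)\<^sup>2" using Ane r_pos[of j] by (simp add: card_gt_0_iff)
    qed
    also have "\<dots> \<le> CARD('a)"
      unfolding A_def using card_large_spectrum_le[OF H, of "r j"] r_pos[of j] by simp
    finally show ?thesis by simp
  qed
  ultimately show False by linarith
qed

end

section \<open>Exponents and transfer to residue rings\<close>

text \<open>With \<open>K = p powr doubling_exponent \<alpha>\<close> as the proportion lost at each level, \<open>loss_degree\<close>
  makes \<open>K ^ loss_degree \<alpha> = p powr (\<alpha> / 2)\<close>. \<open>num_steps\<close> squarings take \<open>p powr (\<alpha> / 2)\<close> past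
  \<open>p\<close>, and \<open>K ^ num_levels \<alpha> \<ge> p\<close> lets the pigeonhole argument stop. Each level squares the
  threshold, whence the power of 2 in \<open>saving_exponent\<close>.\<close>

definition num_steps :: "real \<Rightarrow> nat" where
  "num_steps \<alpha> = nat \<lceil>2 / \<alpha>\<rceil>"

definition loss_degree :: "real \<Rightarrow> nat" where
  "loss_degree \<alpha> = 833 * 13 ^ num_steps \<alpha> + 24"

definition doubling_exponent :: "real \<Rightarrow> real" where
  "doubling_exponent \<alpha> = \<alpha> / (2 * loss_degree \<alpha>)"

definition num_levels :: "real \<Rightarrow> nat" where
  "num_levels \<alpha> = nat \<lceil>1 / doubling_exponent \<alpha>\<rceil>"

definition saving_exponent :: "real \<Rightarrow> real" where
  "saving_exponent \<alpha> = doubling_exponent \<alpha> / 2 ^ (num_levels \<alpha> + 1)"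

lemma loss_degree_pos: "loss_degree \<alpha> > 0"
  by (simp add: loss_degree_def)

lemma doubling_exponent_pos: "\<alpha> > 0 \<Longrightarrow> doubling_exponent \<alpha> > 0"
  by (simp add: doubling_exponent_def loss_degree_pos)

lemma saving_exponent_pos: "\<alpha> > 0 \<Longrightarrow> saving_exponent \<alpha> > 0"
  by (simp add: saving_exponent_def doubling_exponent_pos)

context additive_character
begin

theorem spec_le_powr:
  fixes \<alpha> :: real and H :: "'a set"
  assumes prime_field: "\<And>x::'a. \<exists>n. x = of_nat n"
    and H0: "0 \<notin> H" and Hmult: "\<And>g h. g \<in> H \<Longrightarrow> h \<in> H \<Longrightarrow> g * h \<in> H"
    and \<alpha>: "\<alpha> > 0" and card_H: "real CARD('a) powr \<alpha> < card H" and "\<xi> \<noteq> 0"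
  shows "spec H \<xi> \<le> 2 * real CARD('a) powr (- saving_exponent \<alpha>)"
proof -
  define p where "p = real CARD('a)"
  define \<beta> where "\<beta> = saving_exponent \<alpha>"
  define \<kappa> where "\<kappa> = doubling_exponent \<alpha>"
  define J where "J = num_steps \<alpha>"
  define I where "I = num_levels \<alpha>"
  define Q where "Q = loss_degree \<alpha>"
  have Q: "Q = 833 * 13 ^ J + 24" by (simp add: Q_def loss_degree_def J_def)
  have "2 \<le> CARD('a)" using card_mono[of UNIV "{0, 1::'a}"] by simp
  then have p: "p \<ge> 2" by (simp add: p_def)
  have \<kappa>: "\<kappa> > 0" "\<kappa> * Q = \<alpha> / 2"
    using doubling_exponent_pos[OF \<alpha>] loss_degree_pos[of \<alpha>]
    by (simp_all add: \<kappa>_def Q_def) (simp add: doubling_exponent_def)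
  have \<beta>: "\<beta> > 0" "\<beta> * 2 ^ (I + 1) = \<kappa>"
    using saving_exponent_pos[OF \<alpha>] by (auto simp: \<beta>_def saving_exponent_def I_def \<kappa>_def)
  show ?thesis
  proof (cases "p powr \<beta> \<ge> 2")
    \<comment> \<open>Now 2 p^(-\<beta>) is at least 1 and the trivial bound suffices. This case is
      the origin of the constant 2.\<close>
    case False
    then have "2 * p powr (- \<beta>) \<ge> 1" using p by (simp add: powr_minus field_simps)
    then show ?thesis using spec_le_1[of H \<xi>] by (simp add: p_def \<beta>_def)
  next
    case True
    define K where "K = p powr \<kappa>"
    have "\<beta> \<le> \<kappa>"
    proof -
      have "\<beta> * 1 \<le> \<beta> * 2 ^ (I + 1)" using \<beta>(1) by (intro mult_left_mono one_le_power) auto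
      then show ?thesis using \<beta>(2) by simp
    qed
    then have "p powr \<beta> \<le> K" unfolding K_def using p by (intro powr_mono) auto
    then have K: "K \<ge> 2" using True by simp
    have K_pow: "K ^ n = p powr (\<kappa> * n)" for n
      unfolding K_def using p by (simp add: powr_powr flip: powr_realpow)
    have KQ: "K ^ Q = p powr (\<alpha> / 2)" by (simp only: K_pow \<kappa>(2))
    have "1 / \<kappa> \<le> I" unfolding I_def num_levels_def \<kappa>_def by (rule real_nat_ceiling_ge)
    then have "1 \<le> \<kappa> * I" using \<kappa> by (simp add: field_simps)
    then have I: "I > 0" "CARD('a) \<le> K ^ I"
      using p powr_mono[of 1 "\<kappa> * I" p] by (auto simp: K_pow p_def intro: Nat.gr0I)
    have "2 / \<alpha> \<le> J" unfolding J_def num_steps_def by (rule real_nat_ceiling_ge)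
    also have "real J < 2 ^ J" by (rule of_nat_less_two_power)
    finally have J: "1 < \<alpha> / 2 * 2 ^ J" using \<alpha> by (simp add: field_simps)
    have "K ^ 4 \<le> K ^ Q" using K Q by (intro power_increasing) auto
    then have "p powr (\<alpha> / 2) * K ^ 4 \<le> p powr (\<alpha> / 2) * p powr (\<alpha> / 2)"
      unfolding KQ by (intro mult_left_mono) auto
    also have "\<dots> = p powr \<alpha>" by (simp flip: powr_add)
    also have "\<dots> < card H" using card_H by (simp add: p_def)
    finally have "p powr (\<alpha> / 2) \<le> card H / K ^ 4" using K by (simp add: field_simps)
    then have "(p powr (\<alpha> / 2)) ^ (2 ^ J) \<le> (card H / K ^ 4) ^ (2 ^ J)"
      by (intro power_mono) auto
    moreover have "(p powr (\<alpha> / 2)) ^ (2 ^ J) = p powr (\<alpha> / 2 * 2 ^ J)"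
      using p by (simp add: powr_powr flip: powr_realpow)
    moreover have "p powr 1 < p powr (\<alpha> / 2 * 2 ^ J)" using p J by (intro powr_less_mono) auto
    moreover have "p powr 1 = p" using p by simp
    ultimately have "p < (card H / K ^ 4) ^ (2 ^ J)" by linarith
    then have big: "CARD('a) < (card H / K ^ 4) ^ (2 ^ J)" by (simp only: p_def)
    have "K ^ (833 * 13 ^ J + 23) \<le> K ^ Q" unfolding Q using K by (intro power_increasing) auto
    also have "\<dots> \<le> p powr \<alpha>" unfolding KQ using p \<alpha> by (intro powr_mono) auto
    finally have large: "K ^ (833 * 13 ^ J + 23) < card H" using card_H by (simp add: p_def)
    define \<rho> where "\<rho> = p powr (- \<beta>)"
    have \<rho>: "0 < \<rho>" "\<rho> \<le> 1"
      using p \<beta> powr_mono[of "- \<beta>" 0 p] by (auto simp: \<rho>_def)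
    \<comment> \<open>Since p^\<beta> \<ge> 2, halving \<rho> costs at most another factor
      p^(-\<beta>). This doubling of the exponent is the + 1 in
      \<open>saving_exponent\<close>.\<close>
    have "p powr (- (2 * \<beta>)) = p powr (- \<beta>) * p powr (- \<beta>)" by (simp flip: powr_add)
    also have "\<dots> \<le> p powr (- \<beta>) * (1 / 2)"
      using True p by (intro mult_left_mono) (auto simp: powr_minus field_simps)
    finally have "p powr (- (2 * \<beta>)) \<le> \<rho> / 2" by (simp add: \<rho>_def)
    then have "(p powr (- (2 * \<beta>))) ^ (2 ^ I) \<le> (\<rho> / 2) ^ (2 ^ I)" by (intro power_mono) auto
    moreover have "(p powr (- (2 * \<beta>))) ^ (2 ^ I) = p powr (- \<kappa>)"
      using p \<beta>(2) by (simp add: powr_powr algebra_simps flip: powr_realpow)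
    ultimately have "K * p powr (- \<kappa>) \<le> K * (\<rho> / 2) ^ (2 ^ I)" using K by (intro mult_left_mono) auto
    moreover have "K * p powr (- \<kappa>) = 1" unfolding K_def using p by (simp flip: powr_add)
    ultimately have "1 \<le> K * (\<rho> / 2) ^ (2 ^ I)" by simp
    then have "spec H \<xi> < \<rho>"
      using spec_lt[OF prime_field H0 Hmult K I big large \<rho> _ \<open>\<xi> \<noteq> 0\<close>] by blast
    then have "spec H \<xi> \<le> 2 * \<rho>" using \<rho>(1) by linarith
    then show ?thesis by (simp only: \<rho>_def p_def \<beta>_def)
  qed
qed

end

section \<open>From residue rings on the integers to a field type\<close>

definition std_character :: "'b::prime_card mod_ring \<Rightarrow> complex" where
  "std_character x = exp (2 * of_real pi * \<i> * of_int (to_int_mod_ring x) / of_nat CARD('b))"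

lemma of_int_to_int_mod_ring: "of_int (to_int_mod_ring x) = (x :: 'b::prime_card mod_ring)"
  by (simp add: of_int_of_int_mod_ring)

lemma to_int_mod_ring_of_int: "to_int_mod_ring (of_int n :: 'b::prime_card mod_ring) = n mod int CARD('b)"
  unfolding of_int_of_int_mod_ring by transfer simp

text \<open>Frees the character from the chosen representative, so that additivity reduces to that
  of the exponent over the integers.\<close>

lemma std_character_of_int:
  "std_character (of_int n :: 'b::prime_card mod_ring)
    = exp (2 * of_real pi * \<i> * of_int n / of_nat CARD('b))"
proof -
  define p where "p = int CARD('b)"
  have p: "p > 0" by (simp add: p_def)
  have "(of_int n :: complex) = of_int (p * (n div p) + n mod p)" by simp
  also have "\<dots> = of_int p * of_int (n div p) + of_int (n mod p)"
    by (simp only: of_int_add of_int_mult)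
  finally have "2 * of_real pi * \<i> * of_int n / of_int p
      = 2 * of_real pi * \<i> * of_int (n mod p) / of_int p + of_int (2 * (n div p)) * (of_real pi * \<i>)"
    using p by (simp add: field_simps)
  then have "exp (2 * of_real pi * \<i> * of_int n / of_int p)
      = exp (2 * of_real pi * \<i> * of_int (n mod p) / of_int p)"
    by (auto simp: exp_eq)
  then show ?thesis
    by (simp add: std_character_def to_int_mod_ring_of_int p_def)
qed

interpretation std_character: additive_character "std_character :: 'b::prime_card mod_ring \<Rightarrow> complex"
proof
  fix x y :: "'b mod_ring"
  obtain m n where mn: "x = of_int m" "y = of_int n"
    using of_int_to_int_mod_ring by metis
  have "x + y = of_int (m + n)" by (simp add: mn)
  then show "std_character (x + y) = std_character x * std_character y"
    by (simp only: mn std_character_of_int) (simp add: add_divide_distrib distrib_left exp_add)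
  show "cmod (std_character x) = 1" by (simp add: std_character_def)
next
  have p: "CARD('b) > 1" using prime_card prime_gt_1_nat by blast
  have "std_character (1 :: 'b mod_ring) = exp (2 * of_real pi * \<i> / of_nat CARD('b))"
    using std_character_of_int[of 1, where 'b = 'b] by simp
  moreover have "exp (2 * of_real pi * \<i> / of_nat CARD('b)) \<noteq> (1 :: complex)"
  proof
    assume "exp (2 * of_real pi * \<i> / of_nat CARD('b)) = (1 :: complex)"
    then obtain k :: int where "2 * pi / real CARD('b) = of_int (2 * k) * pi"
      by (auto simp: exp_eq_1)
    then have "1 = real_of_int k * real CARD('b)" using p by (simp add: field_simps)
    then have "1 = k * int CARD('b)" by (metis of_int_1 of_int_eq_iff of_int_mult of_int_of_nat_eq)
    then have "int CARD('b) dvd 1" by (metis dvd_triv_right)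
    then show False using p by simp
  qed
  ultimately show "\<exists>x. std_character (x :: 'b mod_ring) \<noteq> 1" by metis
qed

text \<open>Reduction modulo p carries H injectively to a multiplicatively closed set of non-zero
  field elements, and \<psi> becomes the standard character at x times the image of \<xi>. The sum
  over H is therefore a spectral value at a non-zero frequency.\<close>

lemma character_sum_bound:
  fixes H :: "int set" and \<psi> :: "int \<Rightarrow> complex"
  assumes p: "CARD('b::prime_card) = p" and "\<alpha> > 0"
    and sub: "subgroup H (units_of (residue_ring (int p)))"
    and card_H: "real (card H) > real p powr \<alpha>"
    and \<psi>: "nontrivial_additive_character p \<psi>"
  shows "cmod (\<Sum>x\<in>H. \<psi> x) \<le> 2 * real p powr (- saving_exponent \<alpha>) * real (card H)"
proof -
  have prime: "prime p" using prime_card[where 'a = 'b] p by simp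
  then interpret residues_prime p "residue_ring (int p)"
    by unfold_locales auto
  have units: "Units (residue_ring (int p)) = {1..int p - 1}"
    using res_prime_units_eq prime_gt_0_nat[OF prime] by (simp add: of_nat_diff Suc_leI)
  define f where "f = (of_int :: int \<Rightarrow> 'b mod_ring)"
  have f_mod: "f (n mod int p) = f n" for n
    using of_int_to_int_mod_ring[of "f n"] by (simp add: f_def to_int_mod_ring_of_int p)
  have H: "H \<subseteq> {1..int p - 1}"
    using subgroup.subset[OF sub] by (simp add: units_of_carrier units)
  have f_inj: "x = y" if "f x = f y" "0 \<le> x" "x < int p" "0 \<le> y" "y < int p" for x y
    using that by (metis f_def mod_pos_pos_trivial p to_int_mod_ring_of_int)
  have f0: "f x \<noteq> 0" if "x \<in> {1..int p - 1}" for x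
    using f_inj[of x 0] that by (auto simp: f_def)
  have inj: "inj_on f H" using H by (intro inj_onI f_inj) auto
  obtain \<xi> where \<xi>: "\<xi> \<in> {1..int p - 1}"
    and \<psi>_eq: "\<And>x. x \<in> {0..int p - 1} \<Longrightarrow> \<psi> x = exp (2 * of_real pi * \<i> * of_int x * of_int \<xi> / of_nat p)"
    using \<psi> unfolding nontrivial_additive_character_def units res_carrier_eq by blast
  have \<psi>_std: "\<psi> x = std_character (f x * f \<xi>)" if "x \<in> H" for x
  proof -
    have "\<psi> x = exp (2 * of_real pi * \<i> * of_int (x * \<xi>) / of_nat p)"
      using \<psi>_eq[of x] H that by (auto simp: mult.assoc)
    also have "\<dots> = std_character (f (x * \<xi>))"
      unfolding f_def std_character_of_int by (simp only: p)
    finally show ?thesis by (simp add: f_def)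
  qed
  have mult: "g * h \<in> f ` H" if gh: "g \<in> f ` H" "h \<in> f ` H" for g h
  proof -
    obtain x y where xy: "x \<in> H" "y \<in> H" "g = f x" "h = f y" using gh by auto
    have "(x * y) mod int p \<in> H"
      using subgroup.m_closed[OF sub xy(1,2)] by (simp add: units_of_mult res_mult_eq)
    moreover have "g * h = f ((x * y) mod int p)" unfolding f_mod xy by (simp add: f_def)
    ultimately show ?thesis by blast
  qed
  have card_fH: "card (f ` H) = card H" by (rule card_image[OF inj])
  have "std_character.spec (f ` H) (f \<xi>) \<le> 2 * real CARD('b mod_ring) powr (- saving_exponent \<alpha>)"
  proof (rule std_character.spec_le_powr)
    show "\<exists>n. x = of_nat n" for x :: "'b mod_ring" using surj_of_nat_mod_ring by blast
    show "0 \<notin> f ` H" using H f0 by force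
    show "g * h \<in> f ` H" if "g \<in> f ` H" "h \<in> f ` H" for g h using that by (rule mult)
    show "real CARD('b mod_ring) powr \<alpha> < real (card (f ` H))" using card_H by (simp add: card_fH p)
  qed (use \<open>\<alpha> > 0\<close> f0 \<xi> in auto)
  then have "std_character.spec (f ` H) (f \<xi>) \<le> 2 * real p powr (- saving_exponent \<alpha>)"
    by (simp add: p)
  moreover have "std_character.spec (f ` H) (f \<xi>) = cmod (\<Sum>x\<in>H. \<psi> x) / card H"
    using inj \<psi>_std by (simp add: std_character.spec_def card_fH sum.reindex)
  moreover have "real (card H) > 0" using card_H by (smt (verit) powr_ge_zero)
  ultimately show ?thesis by (simp add: field_simps)
qed

text \<open>The exponent \<alpha> is quantified inside the predicate so that one choice of prime
  serves all exponents: the type built from it cannot depend on \<alpha> either.\<close>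

definition bound_fails :: "nat \<Rightarrow> bool" where
  "bound_fails p \<longleftrightarrow> prime p \<and> (\<exists>\<alpha> H \<psi>. \<alpha> > 0 \<and> subgroup H (units_of (residue_ring (int p))) \<and>
     real (card H) > real p powr \<alpha> \<and> nontrivial_additive_character p \<psi> \<and>
     \<not> cmod (\<Sum>x\<in>H. \<psi> x) \<le> 2 * real p powr (- saving_exponent \<alpha>) * real (card H))"

text \<open>HOL types cannot depend on the prime \<open>p\<close> of the theorem. It suffices to refute a single
  counterexample, so a hypothetical failing prime is chosen once and for all and its field is
  turned into a type.\<close>

definition critical_prime :: nat where
  "critical_prime = (if \<exists>p. bound_fails p then SOME p. bound_fails p else 2)"

text \<open>The default 2 covers the case in which no prime fails, since the type must have prime
  cardinality in either case.\<close>

lemma prime_critical_prime: "prime critical_prime"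
proof (cases "\<exists>p. bound_fails p")
  case True
  have "prime p" if "bound_fails p" for p using that by (simp add: bound_fails_def)
  from this[OF someI_ex[OF True]] show ?thesis using True by (simp add: critical_prime_def)
qed (simp add: critical_prime_def)

typedef critical_index = "{..<critical_prime}"
  using prime_gt_0_nat[OF prime_critical_prime] by auto

lemma CARD_critical_index: "CARD(critical_index) = critical_prime"
  by (simp add: type_definition.card[OF type_definition_critical_index])

instance critical_index :: prime_card
  by standard (simp add: CARD_critical_index prime_critical_prime)

lemma not_bound_fails: "\<not> bound_fails p"
proof
  assume "bound_fails p"
  then have "bound_fails critical_prime"
    unfolding critical_prime_def by (metis someI)
  then show False
    unfolding bound_fails_def using character_sum_bound[OF CARD_critical_index] by blast
qed

theorem theorem1p1:
  shows "\<forall>\<alpha>::real. \<alpha> > 0 \<longrightarrow>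
    (\<exists>\<beta>::real. \<beta> > 0 \<and> (\<exists>C::real. C > 0 \<and>
      (\<forall>(p::nat) (H::int set) (\<psi>::int \<Rightarrow> complex).
         prime p \<longrightarrow>
         subgroup H (units_of (residue_ring (int p))) \<longrightarrow>
         real (card H) > real p powr \<alpha> \<longrightarrow>
         nontrivial_additive_character p \<psi> \<longrightarrow>
         cmod (\<Sum>x\<in>H. \<psi> x) \<le> C * real p powr (- \<beta>) * real (card H))))"
proof (intro allI impI)
  fix \<alpha> :: real assume "\<alpha> > 0"
  then show "\<exists>\<beta>::real. \<beta> > 0 \<and> (\<exists>C::real. C > 0 \<and>
      (\<forall>(p::nat) (H::int set) (\<psi>::int \<Rightarrow> complex).
         prime p \<longrightarrow>
         subgroup H (units_of (residue_ring (int p))) \<longrightarrow>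
         real (card H) > real p powr \<alpha> \<longrightarrow>
         nontrivial_additive_character p \<psi> \<longrightarrow>
         cmod (\<Sum>x\<in>H. \<psi> x) \<le> C * real p powr (- \<beta>) * real (card H)))"
    using saving_exponent_pos not_bound_fails unfolding bound_fails_def
    by (intro exI[of _ "saving_exponent \<alpha>"] conjI exI[of _ "2::real"]) auto
qed

end
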